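(* Let $n\ge1$, let $\boldsymbol x=\{x_1,\dots,x_{2n}\}$ be distinct real points, and let $\boldsymbol\zeta=\{\zeta_1,\dots,\zeta_{n+1}\}\subset\widehat{\mathbb C}$ (distinct, and disjoint from $\boldsymbol x$) be closed under conjugation and solve the stationary relation $$\sum_{j=1}^{2n}\frac{1}{\zeta_k-x_j}=\sum_{l\neq k}\frac{2}{\zeta_k-\zeta_l},\qquad k=1,\dots,n+1.$$ Let $\boldsymbol\rho_j=\sum_{k\ne j}2\delta_{x_k}-\sum_{k=1}^{n+1}4\delta_{\zeta_k}$, and let $g_t$ be the Loewner chain of the $1/4$-superposition of the $\mathrm{SLE}(0,x_j,\boldsymbol\rho_j)$ processes, $j=1,\dots,2n$. Then the function $$Q_t(z)=\prod_{\zeta_k\ne\infty}(z-g_t(\zeta_k))$$ solves the backward heat equation $\dot Q_t=-\tfrac12Q_t''$. Moreover, if $R$ is an element of $\mathrm{CRR}_{n+1}(\boldsymbol x)$ with pole set $\boldsymbol\zeta$, then the rational functions $R_t:=R\circ g_t^{-1}$ follow the parabolic PDE $$\dot R_t(z)=-\frac12R_t''(z)-\frac{Q_t'(z)}{Q_t(z)}R_t'(z),$$ at least until the first collision time between any particles in $\boldsymbol x\cup\boldsymbol\zeta$.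
   Context: Dots denote $t$-derivatives and primes $z$-derivatives. $\widehat{\mathbb C}$ is the Riemann sphere. $\mathrm{CRR}_{n+1}(\boldsymbol x)$ is the set of real rational functions of degree $n+1$ whose critical points are precisely $\boldsymbol x$. One of the $\zeta_k$ may be $\infty$; any fraction whose denominator involves $\infty$ is $0$, and $g_t(\infty)=\infty$. The $1/4$-superposition of the $\mathrm{SLE}(0,x_j,\boldsymbol\rho_j)$ processes is the Loewner chain $$\partial_tg_t(z)=\sum_{j=1}^{2n}\frac{1/2}{g_t(z)-x_j(t)},\qquad g_0(z)=z,$$ where, with $\zeta_k(t)=g_t(\zeta_k)$, the driving functions solve $$\dot x_j=\frac14\Big(\sum_{k\ne j}\frac{2}{x_j-x_k}-\sum_{k=1}^{n+1}\frac{4}{x_j-\zeta_k(t)}\Big)+\sum_{k\ne j}\frac{1/2}{x_j-x_k},\qquad x_j(0)=x_j .$$ Collision refers to any two of the points $x_j(t)$, $\zeta_k(t)$ coinciding. For $t$ before the first collision, $R\circ g_t^{-1}$ (initially defined on $\mathbb H$) is the restriction of a rational function, which is denoted $R_t$. *)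

theory Defs
  imports
    "HOL-Complex_Analysis.Complex_Analysis"
    "HOL-Computational_Algebra.Field_as_Ring"
    "HOL-Computational_Algebra.Normalized_Fraction"
    "HOL-Computational_Algebra.Polynomial_Factorial"
begin

text \<open>
  The Riemann sphere is rendered as \<^typ>\<open>complex option\<close>, with \<^term>\<open>None\<close> as the point at infinity.
\<close>

type_synonym sphere = "complex option"

text \<open>The fraction \<open>c / (a - b)\<close>, which is 0 as soon as \<open>a\<close> or \<open>b\<close> is infinite.\<close>

fun sphere_frac :: "complex \<Rightarrow> sphere \<Rightarrow> sphere \<Rightarrow> complex" where
  "sphere_frac c (Some a) (Some b) = c / (a - b)"
| "sphere_frac c _ _ = 0"

fun sphere_inverse :: "sphere \<Rightarrow> sphere" where
  "sphere_inverse None = Some 0"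
| "sphere_inverse (Some z) = (if z = 0 then None else Some (inverse z))"


text \<open>
  A rational function is an element of the fraction field of \<open>complex poly\<close>;
  \<^const>\<open>quot_of_fract\<close> is its representation in lowest terms, with monic denominator.
\<close>

definition rat_num :: "complex poly fract \<Rightarrow> complex poly" where
  "rat_num R = fst (quot_of_fract R)"

definition rat_den :: "complex poly fract \<Rightarrow> complex poly" where
  "rat_den R = snd (quot_of_fract R)"

definition rat_degree :: "complex poly fract \<Rightarrow> nat" where
  "rat_degree R = max (degree (rat_num R)) (degree (rat_den R))"

text \<open>Because the denominator is monic, realness can be read off the coefficients.\<close>

definition rat_real :: "complex poly fract \<Rightarrow> bool" where
  "rat_real R \<longleftrightarrow> (\<forall>i. coeff (rat_num R) i \<in> \<real> \<and> coeff (rat_den R) i \<in> \<real>)"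

definition rat_eval :: "complex poly fract \<Rightarrow> complex \<Rightarrow> complex" where
  "rat_eval R z = poly (rat_num R) z / poly (rat_den R) z"

fun rat_map :: "complex poly fract \<Rightarrow> sphere \<Rightarrow> sphere" where
  "rat_map R (Some z) = (if poly (rat_den R) z = 0 then None else Some (rat_eval R z))"
| "rat_map R None =
     (if degree (rat_num R) > degree (rat_den R) then None
      else Some (coeff (rat_num R) (degree (rat_den R)) / lead_coeff (rat_den R)))"

definition rat_poles :: "complex poly fract \<Rightarrow> sphere set" where
  "rat_poles R = {a. rat_map R a = None}"

text \<open>
  A point of the sphere is critical if the differential vanishes there, computed in the
  charts \<open>w\<close> and \<open>1 / w\<close> on both the source and the target; in the chosen target chart the
  map is finite near the point, so \<^const>\<open>the\<close> is only applied to finite values there.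
\<close>

definition target_chart :: "(sphere \<Rightarrow> sphere) \<Rightarrow> sphere \<Rightarrow> sphere \<Rightarrow> complex" where
  "target_chart f a b = the (if f a = None then sphere_inverse (f b) else f b)"

fun sphere_critical :: "(sphere \<Rightarrow> sphere) \<Rightarrow> sphere \<Rightarrow> bool" where
  "sphere_critical f (Some z) \<longleftrightarrow> deriv (\<lambda>w. target_chart f (Some z) (Some w)) z = 0"
| "sphere_critical f None \<longleftrightarrow>
     deriv (\<lambda>w. target_chart f None (sphere_inverse (Some w))) 0 = 0"

definition CRR :: "nat \<Rightarrow> real set \<Rightarrow> complex poly fract set" where
  "CRR d A = {R. rat_real R \<and> rat_degree R = d \<and>
     {a. sphere_critical (rat_map R) a} = (\<lambda>y. Some (complex_of_real y)) ` A}"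


definition stationary :: "nat \<Rightarrow> (nat \<Rightarrow> real) \<Rightarrow> (nat \<Rightarrow> sphere) \<Rightarrow> bool" where
  "stationary n x \<zeta> \<longleftrightarrow>
     (\<forall>k\<in>{1..n+1}. (\<Sum>j\<in>{1..2*n}. sphere_frac 1 (\<zeta> k) (Some (of_real (x j))))
        = (\<Sum>l\<in>{1..n+1} - {k}. sphere_frac 2 (\<zeta> k) (\<zeta> l)))"

text \<open>
  \<open>loewner_chain N X T \<sigma> g\<close>: \<open>g\<close> is the flow on the whole complex plane of the Loewner equation
  with driving functions \<open>X t 1, \<dots>, X t N\<close>, \<open>0 \<le> t < T\<close>. The value \<open>\<sigma> z\<close> is the lifetime
  (swallowing time) of \<open>z\<close>, capped at \<open>T\<close>: the solution from \<open>z\<close> runs on \<open>[0, \<sigma> z)\<close> and,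
  if it stops before \<open>T\<close>, it does so because its distance to the driving points is not bounded
  away from 0. Nothing is said about \<open>g t z\<close> for \<open>t \<ge> \<sigma> z\<close>. Time derivatives are one-sided
  at \<open>t = 0\<close>.
\<close>

definition loewner_chain ::
  "nat \<Rightarrow> (real \<Rightarrow> nat \<Rightarrow> real) \<Rightarrow> ereal \<Rightarrow> (complex \<Rightarrow> ereal) \<Rightarrow> (real \<Rightarrow> complex \<Rightarrow> complex) \<Rightarrow> bool"
where
  "loewner_chain N X T \<sigma> g \<longleftrightarrow>
     (\<forall>z. 0 \<le> \<sigma> z \<and> \<sigma> z \<le> T) \<and>
     (\<forall>z. \<sigma> z = 0 \<longleftrightarrow> (\<exists>j\<in>{1..N}. z = of_real (X 0 j))) \<and>
     (\<forall>z. 0 < \<sigma> z \<longrightarrow> g 0 z = z) \<and>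
     (\<forall>z t. 0 \<le> t \<and> ereal t < \<sigma> z \<longrightarrow>
        (\<forall>j\<in>{1..N}. g t z \<noteq> of_real (X t j)) \<and>
        ((\<lambda>s. g s z) has_vector_derivative (\<Sum>j\<in>{1..N}. (1/2) / (g t z - of_real (X t j))))
          (at t within {0..})) \<and>
     (\<forall>z. 0 < \<sigma> z \<and> \<sigma> z < T \<longrightarrow>
        (\<forall>\<epsilon>>0. \<exists>t\<ge>0. ereal t < \<sigma> z \<and> (\<exists>j\<in>{1..N}. cmod (g t z - of_real (X t j)) < \<epsilon>)))"

definition upper_domain :: "(complex \<Rightarrow> ereal) \<Rightarrow> real \<Rightarrow> complex set" where
  "upper_domain \<sigma> t = {z. 0 < Im z \<and> ereal t < \<sigma> z}"

text \<open>Evolution of marked points; \<open>g\<^sub>t\<close> fixes infinity.\<close>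

definition marked :: "(real \<Rightarrow> complex \<Rightarrow> complex) \<Rightarrow> (nat \<Rightarrow> sphere) \<Rightarrow> real \<Rightarrow> nat \<Rightarrow> sphere" where
  "marked g \<zeta> t k = map_option (g t) (\<zeta> k)"

definition superposition_drift :: "nat \<Rightarrow> (nat \<Rightarrow> real) \<Rightarrow> (nat \<Rightarrow> sphere) \<Rightarrow> nat \<Rightarrow> complex" where
  "superposition_drift n x \<zeta> j =
     (1/4) * ((\<Sum>k\<in>{1..2*n} - {j}. 2 / (of_real (x j) - of_real (x k)))
              - (\<Sum>k\<in>{1..n+1}. sphere_frac 4 (Some (of_real (x j))) (\<zeta> k)))
     + (\<Sum>k\<in>{1..2*n} - {j}. (1/2) / (of_real (x j) - of_real (x k)))"

text \<open>
  \<open>X\<close> and \<open>g\<close> are, on \<open>[0, T)\<close>, the driving functions and the Loewner chain of the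
  1/4-superposition of the SLE(0) processes started from \<open>x\<close> with force points
  as prescribed by \<open>x\<close> and \<open>\<zeta>\<close>.
  The drift is real because \<open>\<zeta>\<close> is symmetric under conjugation; the
  equation is nevertheless stated in the complex plane, where the drift lives.
\<close>

definition quarter_superposition ::
  "nat \<Rightarrow> (nat \<Rightarrow> real) \<Rightarrow> (nat \<Rightarrow> sphere) \<Rightarrow> ereal \<Rightarrow> (real \<Rightarrow> nat \<Rightarrow> real) \<Rightarrow> (complex \<Rightarrow> ereal)
     \<Rightarrow> (real \<Rightarrow> complex \<Rightarrow> complex) \<Rightarrow> bool"
where
  "quarter_superposition n x \<zeta> T X \<sigma> g \<longleftrightarrow>
     loewner_chain (2*n) X T \<sigma> g \<and>
     (\<forall>j\<in>{1..2*n}. X 0 j = x j) \<and>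
     (\<forall>j\<in>{1..2*n}. \<forall>t. 0 \<le> t \<and> ereal t < T \<longrightarrow>
        ((\<lambda>s. complex_of_real (X s j)) has_vector_derivative
           superposition_drift n (X t) (marked g \<zeta> t) j) (at t within {0..}))"

text \<open>
  No two of the particles \<open>x\<^sub>j(t)\<close>, \<open>\<zeta>\<^sub>k(t)\<close> coincide at any time \<open>t < T\<close>. A finite \<open>\<zeta>\<^sub>k\<close> whose
  lifetime ends is absorbed by a driving point, so being alive up to \<open>T\<close> is part of this.
\<close>

definition no_collision ::
  "nat \<Rightarrow> (nat \<Rightarrow> sphere) \<Rightarrow> ereal \<Rightarrow> (real \<Rightarrow> nat \<Rightarrow> real) \<Rightarrow> (complex \<Rightarrow> ereal)
     \<Rightarrow> (real \<Rightarrow> complex \<Rightarrow> complex) \<Rightarrow> bool"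
where
  "no_collision n \<zeta> T X \<sigma> g \<longleftrightarrow>
     (\<forall>k\<in>{1..n+1}. \<forall>z. \<zeta> k = Some z \<longrightarrow> T \<le> \<sigma> z) \<and>
     (\<forall>t. 0 \<le> t \<and> ereal t < T \<longrightarrow>
        inj_on (X t) {1..2*n} \<and> inj_on (marked g \<zeta> t) {1..n+1} \<and>
        (\<forall>j\<in>{1..2*n}. \<forall>k\<in>{1..n+1}. marked g \<zeta> t k \<noteq> Some (of_real (X t j))))"

definition Qpoly :: "nat \<Rightarrow> (nat \<Rightarrow> sphere) \<Rightarrow> (real \<Rightarrow> complex \<Rightarrow> complex) \<Rightarrow> real \<Rightarrow> complex \<Rightarrow> complex" where
  "Qpoly n \<zeta> g t z = (\<Prod>k\<in>{k\<in>{1..n+1}. \<zeta> k \<noteq> None}. z - g t (the (\<zeta> k)))"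

end

theory Submission
  imports Defs
begin

text \<open>
  Let \<open>P\<close> and \<open>Q\<close> be the monic polynomials with the driving points, respectively the finite marked
  points, as roots. Comparing values at all these points shows that
  \<open>\<partial>\<^sub>t (P / Q\<^sup>2) = - (P' / Q\<^sup>2)' / 2\<close>. The right-hand side is an exact derivative, so the residues of
  \<open>P / Q\<^sup>2\<close> at the marked points are conserved; the stationary relation says that they vanish, hence
  it persists. Under it \<open>\<zeta>\<^sub>k\<close> moves with velocity \<open>\<Sum> 1 / (\<zeta>\<^sub>k - \<zeta>\<^sub>l)\<close>, which is the backward heat
  equation for \<open>Q\<close>, and \<open>P / Q\<^sup>2\<close> has a rational primitive. A function \<open>R\<close> with critical points at
  the roots of \<open>P\<close> and simple poles at those of \<open>Q\<close> has \<open>R' = c P / Q\<^sup>2\<close>; its time evolution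
  \<open>R\<^sub>t\<close> keeps this form, with the same \<open>c\<close>, and satisfies \<open>\<partial>\<^sub>t R\<^sub>t = - c P' / (2 Q\<^sup>2)\<close>. This is the
  parabolic equation, and since \<open>\<partial>\<^sub>t g\<^sub>t = P' / (2 P)\<close> along the Loewner flow, it also says that
  \<open>R\<^sub>t \<circ> g\<^sub>t\<close> is constant in time. That \<open>g\<^sub>t\<close> maps onto the upper half-plane follows by running the
  flow backwards, which moves points away from the real line.
\<close>

section \<open>Products of linear factors\<close>

text \<open>Roots are indexed by a set, so that a factor can be removed or differentiated in time
  while its root moves; the value is a polynomial, so that degrees are available.\<close>

definition linprod :: "'b set \<Rightarrow> ('b \<Rightarrow> complex) \<Rightarrow> complex poly" where
  "linprod I a = (\<Prod>i\<in>I. [:- a i, 1:])"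

lemma degree_linprod [simp]: "degree (linprod I a) = card I"
proof -
  have "degree (linprod I a) = (\<Sum>i\<in>I. degree [:- a i, 1:])"
    unfolding linprod_def by (rule degree_prod_eq_sum_degree) auto
  then show ?thesis by simp
qed

lemma lead_coeff_linprod [simp]: "coeff (linprod I a) (card I) = 1"
  using lead_coeff_prod[of "\<lambda>i. [:- a i, 1:]" I] by (simp flip: linprod_def)

lemma linprod_nonzero [simp]: "linprod I a \<noteq> 0"
  using lead_coeff_linprod[of I a] by (metis coeff_0 zero_neq_one)

lemma poly_linprod: "poly (linprod I a) z = (\<Prod>i\<in>I. z - a i)"
  by (simp add: linprod_def poly_prod)

lemma poly_linprod_eq_0_iff: "finite I \<Longrightarrow> poly (linprod I a) z = 0 \<longleftrightarrow> (\<exists>i\<in>I. z = a i)"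
  by (auto simp: poly_linprod)

lemma linprod_remove:
  "finite I \<Longrightarrow> k \<in> I \<Longrightarrow> linprod I a = [:- a k, 1:] * linprod (I - {k}) a"
  by (simp add: linprod_def prod.remove)

lemma pderiv_linear_mult: "pderiv ([:- c, 1:] * p) = p + [:- c, 1:] * pderiv p"
  for c :: "'a :: idom"
  by (simp add: pderiv_mult pderiv_pCons del: mult_pCons_left)

lemma poly_linprod_remove_nonzero:
  "finite I \<Longrightarrow> inj_on a I \<Longrightarrow> k \<in> I \<Longrightarrow> poly (linprod (I - {k}) a) (a k) \<noteq> 0"
  by (auto simp: poly_linprod_eq_0_iff dest: inj_onD)

text \<open>The logarithmic derivative of a product. It turns the sums in the equations of motion
  into values of \<open>p' / p\<close>.\<close>

lemma poly_pderiv_linprod: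
  assumes "finite I" "\<And>i. i \<in> I \<Longrightarrow> z \<noteq> a i"
  shows "poly (pderiv (linprod I a)) z = poly (linprod I a) z * (\<Sum>i\<in>I. 1 / (z - a i))"
  using assms
proof (induction I)
  case (insert k I)
  have e: "linprod (insert k I) a = [:- a k, 1:] * linprod I a"
    using insert by (simp add: linprod_def)
  have "poly (pderiv (linprod (insert k I) a)) z
      = poly (linprod I a) z + (z - a k) * (poly (linprod I a) z * (\<Sum>i\<in>I. 1 / (z - a i)))"
    unfolding e pderiv_linear_mult poly_add poly_mult using insert by simp
  moreover have "poly (linprod (insert k I) a) z = (z - a k) * poly (linprod I a) z"
    unfolding e poly_mult by simp
  moreover have "z - a k \<noteq> 0" using insert.prems[of k] by simp
  ultimately show ?case
    using insert.hyps by (simp add: distrib_left)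
qed (simp add: linprod_def)

text \<open>Differentiate \<open>(z - a k) * q\<close> once and twice: at \<open>a k\<close> only
  \<open>q\<close> and \<open>2 * q'\<close> survive.\<close>

lemma
  assumes "finite I" "k \<in> I"
  shows poly_pderiv_linprod_root:
      "poly (pderiv (linprod I a)) (a k) = poly (linprod (I - {k}) a) (a k)"
    and poly_pderiv2_linprod_root:
      "poly (pderiv (pderiv (linprod I a))) (a k) = 2 * poly (pderiv (linprod (I - {k}) a)) (a k)"
  by (simp_all add: linprod_remove[OF assms, of a] pderiv_linear_mult pderiv_add del: mult_pCons_left)

text \<open>As in Lagrange interpolation, a term with \<open>i \<noteq> k\<close> keeps the factor
  \<open>z - a k\<close> and vanishes at \<open>a k\<close>.\<close>

lemma poly_sum_linprod_remove:
  assumes "finite I" "k \<in> I"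
  shows "poly (\<Sum>i\<in>I. smult (c i) (linprod (I - {i}) a)) (a k) = c k * poly (linprod (I - {k}) a) (a k)"
proof -
  have "poly (\<Sum>i\<in>I. smult (c i) (linprod (I - {i}) a)) (a k)
      = (\<Sum>i\<in>I. if i = k then c k * poly (linprod (I - {k}) a) (a k) else 0)"
    unfolding poly_sum
    using assms by (intro sum.cong) (auto simp: poly_linprod_eq_0_iff)
  then show ?thesis using assms by simp
qed

lemma degree_sum_linprod_remove:
  "degree (\<Sum>i\<in>I. smult (c i) (linprod (I - {i}) a)) \<le> card I - 1"
  by (cases "finite I") (auto intro!: degree_sum_le order.trans[OF degree_smult_le])

section \<open>Polynomials determined by their roots\<close>

lemma poly_0_if_roots:
  fixes a :: "'b \<Rightarrow> complex"
  assumes "inj_on a I" "\<And>i. i \<in> I \<Longrightarrow> poly p (a i) = 0" "degree p < card I"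
  shows "p = 0"
  using assms by (intro poly_eqI_degree[of "a ` I"]) (auto simp: card_image)

text \<open>The remainder modulo the product vanishes at \<open>card I\<close> points and has
  smaller degree, hence is 0.\<close>

lemma linprod_dvd:
  fixes a :: "'b \<Rightarrow> complex"
  assumes "inj_on a I" "finite I" "\<And>i. i \<in> I \<Longrightarrow> poly p (a i) = 0"
  shows "linprod I a dvd p"
proof (cases "I = {}")
  case False
  have "p mod linprod I a = 0"
  proof (rule poly_0_if_roots[OF assms(1)])
    fix i assume i: "i \<in> I"
    have "poly p (a i) = poly (p div linprod I a * linprod I a + p mod linprod I a) (a i)"
      by (simp only: div_mult_mod_eq)
    moreover have "poly (linprod I a) (a i) = 0"
      using i assms(2) by (auto simp: poly_linprod_eq_0_iff)
    ultimately show "poly (p mod linprod I a) (a i) = 0"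
      using assms(3)[OF i] by simp
  next
    show "degree (p mod linprod I a) < card I"
      using degree_mod_less'[of "linprod I a" p] False assms(2) by (cases "p mod linprod I a = 0") (auto simp: card_gt_0_iff)
  qed
  then show ?thesis by auto
qed (simp add: linprod_def)

text \<open>Divide out the simple roots. At \<open>a i\<close> the derivative of
  \<open>linprod I a * q\<close> is a nonzero number times the value of \<open>q\<close>, so the
  cofactor vanishes at all the points again, and its degree is below \<open>card I\<close>.\<close>

lemma poly_0_if_double_roots:
  fixes a :: "'b \<Rightarrow> complex"
  assumes "inj_on a I" "finite I" "\<And>i. i \<in> I \<Longrightarrow> poly p (a i) = 0"
    "\<And>i. i \<in> I \<Longrightarrow> poly (pderiv p) (a i) = 0" "degree p < 2 * card I"
  shows "p = 0"
proof -
  obtain q where q: "p = linprod I a * q"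
    using linprod_dvd[OF assms(1-3)] by auto
  have "q = 0"
  proof (rule ccontr)
    assume "q \<noteq> 0"
    then have "degree p = card I + degree q" by (simp add: q degree_mult_eq)
    then have "degree q < card I" using assms(5) by simp
    moreover have "poly q (a i) = 0" if "i \<in> I" for i
    proof -
      have "poly (linprod I a) (a i) = 0" using that assms(2) by (auto simp: poly_linprod_eq_0_iff)
      then show ?thesis
        using assms(4)[OF that] that assms(2) poly_linprod_remove_nonzero[OF assms(2,1) that]
        by (simp add: q pderiv_mult poly_pderiv_linprod_root)
    qed
    ultimately show False using poly_0_if_roots[OF assms(1)] \<open>q \<noteq> 0\<close> by blast
  qed
  then show ?thesis by (simp add: q)
qed

lemma degree_less_if_coeff_0:
  assumes "degree p \<le> d" "coeff p d = 0" "0 < d"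
  shows "degree p < d"
  using assms by (metis coeff_0 degree_0 leading_coeff_0_iff le_neq_implies_less)

text \<open>This is \<open>(p / q\<^sup>2)' = 0\<close>; the degree condition says that \<open>p / q\<^sup>2\<close> vanishes at infinity.\<close>
lemma eq_0_if_pderiv_over_square_0:
  fixes p q :: "complex poly"
  assumes e: "pderiv p * q = 2 * p * pderiv q" and d: "degree p < 2 * degree q"
  shows "p = 0"
proof (rule ccontr)
  assume p: "p \<noteq> 0"
  have dq: "degree q > 0" using d by simp
  have q: "q \<noteq> 0" using d by auto
  \<comment> \<open>In degree \<open>degree p + degree q - 1\<close> the two sides have coefficients
    \<open>degree p\<close> and \<open>2 * degree q\<close> times the product of the leading
    coefficients, so equality would force \<open>degree p = 2 * degree q\<close>.\<close>
  have "coeff (pderiv p * q) (degree p + degree q - 1) = of_nat (degree p) * lead_coeff p * lead_coeff q"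
  proof (cases "degree p = 0")
    case True
    then show ?thesis by (metis coeff_0 mult_zero_left of_nat_0 pderiv_eq_0_iff)
  next
    case False
    then have "degree p + degree q - 1 = degree (pderiv p) + degree q" by (simp add: degree_pderiv)
    moreover have "coeff (pderiv p) (degree p - 1) = of_nat (degree p) * lead_coeff p"
      using False by (simp add: coeff_pderiv)
    ultimately show ?thesis by (metis coeff_mult_degree_sum degree_pderiv)
  qed
  moreover have "coeff (2 * p * pderiv q) (degree p + degree q - 1) = 2 * of_nat (degree q) * lead_coeff p * lead_coeff q"
  proof -
    have "degree p + degree q - 1 = degree p + degree (pderiv q)" using dq by (simp add: degree_pderiv)
    then have "coeff (p * pderiv q) (degree p + degree q - 1) = of_nat (degree q) * lead_coeff p * lead_coeff q"
    proof -
      have "coeff (pderiv q) (degree q - 1) = of_nat (degree q) * lead_coeff q"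
        using dq by (simp add: coeff_pderiv)
      then show ?thesis
        using dq by (metis \<open>degree p + degree q - 1 = degree p + degree (pderiv q)\<close> coeff_mult_degree_sum degree_pderiv mult.assoc mult.commute)
    qed
    moreover have "2 * p * pderiv q = smult 2 (p * pderiv q)"
      by (simp add: numeral_poly)
    ultimately show ?thesis by simp
  qed
  ultimately have "of_nat (degree p) = (2 * of_nat (degree q) :: complex)"
    using e p q by simp
  then have "degree p = 2 * degree q"
    by (metis of_nat_eq_iff of_nat_mult of_nat_numeral)
  with d show False by simp
qed

section \<open>Polynomials depending on time\<close>

lemma has_vector_derivative_field_chain:
  fixes f :: "real \<Rightarrow> complex"
  assumes "(f has_vector_derivative f') (at t within S)" "(h has_field_derivative h') (at (f t))"
  shows "((\<lambda>s. h (f s)) has_vector_derivative f' * h') (at t within S)"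
  using field_vector_diff_chain_within[OF assms(1) has_field_derivative_at_within[OF assms(2)]]
  by (simp add: o_def)

lemma has_vector_derivative_power_complex:
  fixes f :: "real \<Rightarrow> complex"
  assumes "(f has_vector_derivative f') (at t within S)"
  shows "((\<lambda>s. f s ^ i) has_vector_derivative of_nat i * f t ^ (i - 1) * f') (at t within S)"
  using has_vector_derivative_field_chain[OF assms, of "\<lambda>z. z ^ i" "of_nat i * f t ^ (i - 1)"]
    DERIV_power[of "\<lambda>z. z" 1 "f t" UNIV i] by (simp add: mult.commute)

lemma has_vector_derivative_quotient:
  fixes f h :: "real \<Rightarrow> complex"
  assumes "(f has_vector_derivative f') (at t within S)" "(h has_vector_derivative h') (at t within S)"
    and "h t \<noteq> 0"
  shows "((\<lambda>s. f s / h s) has_vector_derivative (f' * h t - f t * h') / (h t)\<^sup>2) (at t within S)"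
proof -
  have "((\<lambda>s. inverse (h s)) has_vector_derivative h' * (- (inverse (h t) ^ Suc (Suc 0)))) (at t within S)"
    using assms(3) by (intro has_vector_derivative_field_chain[OF assms(2)] DERIV_inverse)
  from has_vector_derivative_mult[OF assms(1) this] show ?thesis
    using assms(3) by (simp add: field_simps power2_eq_square)
qed

lemma poly_eq_sum_le: "degree p \<le> d \<Longrightarrow> poly p z = (\<Sum>i\<le>d. coeff p i * z ^ i)"
  for p :: "'a :: comm_ring_1 poly"
  by (subst poly_as_sum_of_monoms'[of p d, symmetric]) (simp_all add: poly_sum poly_monom)

lemma pderiv_sum: "pderiv (\<Sum>i\<in>I. p i) = (\<Sum>i\<in>I. pderiv (p i))"
  by (induction I rule: infinite_finite_induct) (simp_all add: pderiv_add)

lemma poly_pderiv_eq_sum_le: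
  "degree p \<le> d \<Longrightarrow> poly (pderiv p) z = (\<Sum>i\<le>d. of_nat i * coeff p i * z ^ (i - 1))"
  for p :: "'a :: idom poly"
  by (subst poly_as_sum_of_monoms'[of p d, symmetric])
     (simp_all add: poly_sum poly_monom pderiv_sum pderiv_monom)

text \<open>The common degree bound makes evaluation a sum over a range independent of time.\<close>

definition has_poly_derivative ::
  "nat \<Rightarrow> (real \<Rightarrow> complex poly) \<Rightarrow> complex poly \<Rightarrow> real \<Rightarrow> real set \<Rightarrow> bool"
where
  "has_poly_derivative d p p' t S \<longleftrightarrow> degree p' \<le> d \<and> (\<forall>s. degree (p s) \<le> d) \<and>
     (\<forall>i. ((\<lambda>s. coeff (p s) i) has_vector_derivative coeff p' i) (at t within S))"

lemma has_poly_derivative_degree: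
  assumes "has_poly_derivative d p p' t S"
  shows "degree p' \<le> d" "degree (p s) \<le> d"
  using assms by (auto simp: has_poly_derivative_def)

lemma has_poly_derivative_const: "degree p \<le> d \<Longrightarrow> has_poly_derivative d (\<lambda>_. p) 0 t S"
  by (simp add: has_poly_derivative_def)

lemma has_poly_derivative_add:
  "has_poly_derivative d p p' t S \<Longrightarrow> has_poly_derivative d q q' t S \<Longrightarrow>
     has_poly_derivative d (\<lambda>s. p s + q s) (p' + q') t S"
  by (auto simp: has_poly_derivative_def intro!: has_vector_derivative_add degree_add_le)

lemma has_poly_derivative_diff:
  "has_poly_derivative d p p' t S \<Longrightarrow> has_poly_derivative d q q' t S \<Longrightarrow>
     has_poly_derivative d (\<lambda>s. p s - q s) (p' - q') t S"
  by (auto simp: has_poly_derivative_def intro!: has_vector_derivative_diff degree_diff_le)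

lemma has_poly_derivative_mono:
  "has_poly_derivative d p p' t S \<Longrightarrow> d \<le> e \<Longrightarrow> has_poly_derivative e p p' t S"
  by (auto simp: has_poly_derivative_def intro: order.trans)

lemma has_poly_derivative_mult:
  assumes "has_poly_derivative d p p' t S" "has_poly_derivative e q q' t S"
  shows "has_poly_derivative (d + e) (\<lambda>s. p s * q s) (p' * q t + p t * q') t S"
  unfolding has_poly_derivative_def
proof (intro conjI allI)
  show "degree (p' * q t + p t * q') \<le> d + e"
    using assms by (auto simp: has_poly_derivative_def intro!: degree_add_le order.trans[OF degree_mult_le] add_mono)
  show "degree (p s * q s) \<le> d + e" for s
    using assms by (auto simp: has_poly_derivative_def intro!: order.trans[OF degree_mult_le] add_mono)
  show "((\<lambda>s. coeff (p s * q s) i) has_vector_derivative coeff (p' * q t + p t * q') i) (at t within S)" for i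
  proof -
    have "((\<lambda>s. \<Sum>j\<le>i. coeff (p s) j * coeff (q s) (i - j)) has_vector_derivative
        (\<Sum>j\<le>i. coeff (p t) j * coeff q' (i - j) + coeff p' j * coeff (q t) (i - j))) (at t within S)"
      using assms unfolding has_poly_derivative_def
      by (intro has_vector_derivative_sum has_vector_derivative_mult) auto
    then show ?thesis by (simp add: coeff_mult sum.distrib add.commute)
  qed
qed

lemma has_poly_derivative_smult:
  assumes "(c has_vector_derivative c') (at t within S)" "has_poly_derivative d p p' t S"
  shows "has_poly_derivative d (\<lambda>s. smult (c s) (p s)) (smult (c t) p' + smult c' (p t)) t S"
  using assms
  by (auto simp: has_poly_derivative_def simp del: degree_smult_eq
      intro!: has_vector_derivative_mult degree_add_le order.trans[OF degree_smult_le])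

lemma has_poly_derivative_sum:
  assumes "\<And>i. i \<in> I \<Longrightarrow> has_poly_derivative d (\<lambda>s. p s i) (p' i) t S"
  shows "has_poly_derivative d (\<lambda>s. \<Sum>i\<in>I. p s i) (\<Sum>i\<in>I. p' i) t S"
  using assms
  by (cases "finite I")
     (auto simp: has_poly_derivative_def coeff_sum intro!: has_vector_derivative_sum degree_sum_le)

lemma has_poly_derivative_pderiv:
  assumes "has_poly_derivative d p p' t S"
  shows "has_poly_derivative d (\<lambda>s. pderiv (p s)) (pderiv p') t S"
  unfolding has_poly_derivative_def
proof (intro conjI allI)
  show "degree (pderiv p') \<le> d" "degree (pderiv (p s)) \<le> d" for s
    using has_poly_derivative_degree[OF assms] by (auto simp: degree_pderiv intro: le_trans[OF diff_le_self])
  show "((\<lambda>s. coeff (pderiv (p s)) i) has_vector_derivative coeff (pderiv p') i) (at t within S)" for i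
    using assms unfolding has_poly_derivative_def coeff_pderiv
    by (auto intro!: has_vector_derivative_mult_right)
qed

lemma has_poly_derivative_linear:
  assumes "(a has_vector_derivative a') (at t within S)"
  shows "has_poly_derivative 1 (\<lambda>s. [:- a s, 1:]) [:- a':] t S"
  using assms
  by (auto simp: has_poly_derivative_def coeff_pCons split: nat.split intro!: has_vector_derivative_minus)

lemma has_poly_derivative_linprod:
  assumes "finite I" "\<And>i. i \<in> I \<Longrightarrow> ((\<lambda>s. a s i) has_vector_derivative a' i) (at t within S)"
  shows "has_poly_derivative (card I) (\<lambda>s. linprod I (a s))
           (\<Sum>i\<in>I. smult (- a' i) (linprod (I - {i}) (a t))) t S"
  using assms
proof (induction I)
  case empty
  then show ?case by (simp add: linprod_def has_poly_derivative_const)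
next
  case (insert k I)
  have e: "linprod (insert k I) b = [:- b k, 1:] * linprod I b" for b :: "'a \<Rightarrow> complex"
    using insert.hyps by (simp add: linprod_def)
  \<comment> \<open>Removing an old index leaves the new factor in place, so that it can be pulled
    out of the sum.\<close>
  have f: "linprod (insert k I - {i}) (a t) = [:- a t k, 1:] * linprod (I - {i}) (a t)" if "i \<in> I" for i
  proof -
    have "insert k I - {i} = insert k (I - {i})" using that insert.hyps by auto
    then show ?thesis using insert.hyps by (simp add: linprod_def)
  qed
  have "(\<Sum>i\<in>insert k I. smult (- a' i) (linprod (insert k I - {i}) (a t)))
      = [:- a' k:] * linprod I (a t) + (\<Sum>i\<in>I. smult (- a' i) (linprod (insert k I - {i}) (a t)))"
    using insert.hyps by simp
  also have "(\<Sum>i\<in>I. smult (- a' i) (linprod (insert k I - {i}) (a t)))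
      = [:- a t k, 1:] * (\<Sum>i\<in>I. smult (- a' i) (linprod (I - {i}) (a t)))"
    unfolding sum_distrib_left by (intro sum.cong refl) (simp only: f mult_smult_right)
  finally show ?case
    using has_poly_derivative_mult[OF has_poly_derivative_linear[of "\<lambda>s. a s k"] insert.IH] insert
    unfolding e by (simp del: mult_pCons_left)
qed

text \<open>Used at moving roots and along trajectories. Over a fixed range of exponents it reduces
  to the product rule.\<close>

lemma has_vector_derivative_poly_moving:
  assumes p: "has_poly_derivative d p p' t S" and z: "(z has_vector_derivative z') (at t within S)"
  shows "((\<lambda>s. poly (p s) (z s)) has_vector_derivative poly p' (z t) + poly (pderiv (p t)) (z t) * z')
           (at t within S)"
proof -
  have "((\<lambda>s. \<Sum>i\<le>d. coeff (p s) i * z s ^ i) has_vector_derivative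
      (\<Sum>i\<le>d. coeff (p t) i * (of_nat i * z t ^ (i - 1) * z') + coeff p' i * z t ^ i)) (at t within S)"
    using p unfolding has_poly_derivative_def
    by (intro has_vector_derivative_sum has_vector_derivative_mult has_vector_derivative_power_complex z) auto
  moreover have "(\<Sum>i\<le>d. coeff (p t) i * (of_nat i * z t ^ (i - 1) * z') + coeff p' i * z t ^ i)
      = poly p' (z t) + poly (pderiv (p t)) (z t) * z'"
    using has_poly_derivative_degree[OF p]
    by (simp add: poly_eq_sum_le poly_pderiv_eq_sum_le[of _ d] sum.distrib sum_distrib_left mult_ac)
  ultimately show ?thesis
    using has_poly_derivative_degree[OF p] by (simp add: poly_eq_sum_le[of _ d])
qed

lemma has_vector_derivative_poly:
  "has_poly_derivative d p p' t S \<Longrightarrow>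
     ((\<lambda>s. poly (p s) z) has_vector_derivative poly p' z) (at t within S)"
  using has_vector_derivative_poly_moving[of d p p' t S "\<lambda>_. z" 0] by simp

section \<open>The particle flow\<close>

text \<open>
  The hypothesis is the equation for \<open>P / Q\<^sup>2\<close> with \<open>Q = w B\<close>, cleared of denominators, where \<open>Pd\<close>, \<open>Bd\<close> and
  \<open>v\<close> stand for the time derivatives of \<open>P\<close>, \<open>B\<close> and \<open>\<zeta>\<close>. The residue of \<open>P / Q\<^sup>2\<close> at \<open>\<zeta>\<close> is
  \<open>(P' B - 2 P B') / B\<^sup>3\<close>, and the conclusion says that its time derivative is 0.
\<close>

lemma residue_conserved:
  fixes P B Pd Bd :: "complex poly" and \<zeta> v :: complex
  defines "w \<equiv> [:- \<zeta>, 1:]"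
  assumes eq: "2 * (w * B) * Pd - 4 * P * (w * Bd - smult v B) + pderiv (pderiv P) * (w * B)
      - 2 * pderiv P * pderiv (w * B) = 0"
    and B: "poly B \<zeta> \<noteq> 0"
  shows "poly (pderiv Pd * B + pderiv P * Bd - 2 * (Pd * pderiv B + P * pderiv Bd)
      + smult v (pderiv (pderiv P * B - 2 * P * pderiv B))) \<zeta> * poly B \<zeta>
    = 3 * poly (pderiv P * B - 2 * P * pderiv B) \<zeta> * poly (Bd + smult v (pderiv B)) \<zeta>"
proof -
  \<comment> \<open>\<open>N\<close> is the zero polynomial, so its value and its first two
    derivatives at \<open>\<zeta>\<close> give three relations.\<close>
  define N where "N = 2 * (w * B) * Pd - 4 * P * (w * Bd - smult v B) + pderiv (pderiv P) * (w * B)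
      - 2 * pderiv P * pderiv (w * B)"
  have w0: "poly w \<zeta> = 0" and w1: "pderiv w = 1"
    by (simp_all add: w_def pderiv_pCons)
  have N: "N = 0" using eq by (simp add: N_def)
  note s = N_def pderiv_add pderiv_diff pderiv_mult pderiv_smult pderiv_minus w1
  define p0 p1 p2 p3 b0 b1 b2 q0 q1 d0 d1
    where "p0 = poly P \<zeta>" "p1 = poly (pderiv P) \<zeta>" "p2 = poly (pderiv (pderiv P)) \<zeta>"
      "p3 = poly (pderiv (pderiv (pderiv P))) \<zeta>"
      "b0 = poly B \<zeta>" "b1 = poly (pderiv B) \<zeta>" "b2 = poly (pderiv (pderiv B)) \<zeta>"
      "q0 = poly Pd \<zeta>" "q1 = poly (pderiv Pd) \<zeta>" "d0 = poly Bd \<zeta>" "d1 = poly (pderiv Bd) \<zeta>"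
  note defs = this
  have "poly N \<zeta> = 4 * p0 * v * b0 - 2 * p1 * b0"
    by (simp add: s w0 defs)
  then have p1: "p1 = 2 * v * p0" using B N by (simp add: defs mult.assoc)
  have e1: "poly (pderiv N) \<zeta> = 2*b0*q0 - 4*p0*d0 + 4 * v * p1*b0 + 4 * v * p0*b1 - p2*b0 - 4*p1*b1"
    by (simp add: s w0 defs algebra_simps)
  \<comment> \<open>The third derivative of \<open>P\<close> cancels between the last two terms of
    \<open>N\<close>.\<close>
  have e2: "poly (pderiv (pderiv N)) \<zeta> = 4*(b1*q0 + b0*q1) - 8*(p1*d0 + p0*d1)
      + 4 * v * (p2*b0 + 2*p1*b1 + p0*b2) - 6*p2*b1 - 6*p1*b2"
    by (simp add: s w0 defs algebra_simps)
  \<comment> \<open>Once \<open>p1 = 2 * v * p0\<close> is inserted, four times the claim is a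
    linear combination of the relations from \<open>N''\<close> and \<open>N'\<close>.\<close>
  have "4 * ((q1*b0 + p1*d0 - 2*(q0*b1 + p0*d1) + v * (p2*b0 + p1*b1 - 2*(p1*b1 + p0*b2)))*b0)
      - 4 * (3 * (p1*b0 - 2*p0*b1) * (d0 + v * b1))
    = b0 * poly (pderiv (pderiv N)) \<zeta> - 6 * b1 * poly (pderiv N) \<zeta>"
    unfolding e1 e2 p1 by algebra
  then have "(q1*b0 + p1*d0 - 2*(q0*b1 + p0*d1) + v * (p2*b0 + p1*b1 - 2*(p1*b1 + p0*b2)))*b0
      = 3 * (p1*b0 - 2*p0*b1) * (d0 + v * b1)"
    by (simp add: N)
  then show ?thesis
    by (simp add: defs pderiv_add pderiv_diff pderiv_mult pderiv_smult algebra_simps)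
qed


text \<open>The velocities are those of the quarter superposition after collecting
  \<open>1/4 * 2 + 1/2 = 1\<close> and \<open>1/4 * 4 = 1\<close>. \<open>K\<close> indexes the
  finite marked points. Derivatives within \<open>{0..}\<close> are one-sided at time 0.\<close>

locale particle_flow =
  fixes I :: "'i set" and K :: "'k set"
    and x :: "real \<Rightarrow> 'i \<Rightarrow> complex" and \<zeta> :: "real \<Rightarrow> 'k \<Rightarrow> complex" and T :: ereal
  assumes finite_I: "finite I" and finite_K: "finite K" and I_ne: "I \<noteq> {}" and K_ne: "K \<noteq> {}"
    and inj_x: "\<lbrakk>0 \<le> t; ereal t < T\<rbrakk> \<Longrightarrow> inj_on (x t) I"
    and inj_\<zeta>: "\<lbrakk>0 \<le> t; ereal t < T\<rbrakk> \<Longrightarrow> inj_on (\<zeta> t) K"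
    and disjoint: "\<lbrakk>0 \<le> t; ereal t < T; i \<in> I; k \<in> K\<rbrakk> \<Longrightarrow> x t i \<noteq> \<zeta> t k"
    and x_deriv: "\<lbrakk>0 \<le> t; ereal t < T; i \<in> I\<rbrakk> \<Longrightarrow> ((\<lambda>s. x s i) has_vector_derivative
        (\<Sum>j\<in>I - {i}. 1 / (x t i - x t j)) - (\<Sum>k\<in>K. 1 / (x t i - \<zeta> t k))) (at t within {0..})"
    and \<zeta>_deriv: "\<lbrakk>0 \<le> t; ereal t < T; k \<in> K\<rbrakk> \<Longrightarrow> ((\<lambda>s. \<zeta> s k) has_vector_derivative
        (\<Sum>i\<in>I. (1/2) / (\<zeta> t k - x t i))) (at t within {0..})"
begin

definition P where "P t = linprod I (x t)"
definition Q where "Q t = linprod K (\<zeta> t)"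
text \<open>The cofactor of the \<open>k\<close>-th root of \<open>Q\<close>. Near
  \<open>\<zeta> t k\<close> the function \<open>P / Q^2\<close> is \<open>P / B^2\<close> divided
  by \<open>(z - \<zeta> t k)^2\<close>.\<close>

definition B where "B t k = linprod (K - {k}) (\<zeta> t)"
definition x' where
  "x' t i = (\<Sum>j\<in>I - {i}. 1 / (x t i - x t j)) - (\<Sum>k\<in>K. 1 / (x t i - \<zeta> t k))"
definition \<zeta>' where "\<zeta>' t k = (\<Sum>i\<in>I. (1/2) / (\<zeta> t k - x t i))"
text \<open>The time derivatives of \<open>P\<close>, \<open>Q\<close> and \<open>B\<close>, written
  out by the product rule as polynomials, so that identities between them can be proved by counting
  roots.\<close>

definition Pd where "Pd t = (\<Sum>i\<in>I. smult (- x' t i) (linprod (I - {i}) (x t)))"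
definition Qd where "Qd t = (\<Sum>k\<in>K. smult (- \<zeta>' t k) (B t k))"
definition Bd where
  "Bd t k = (\<Sum>l\<in>K - {k}. smult (- \<zeta>' t l) (linprod (K - {k} - {l}) (\<zeta> t)))"

lemma card_pos: "0 < card I" "0 < card K"
  using finite_I finite_K I_ne K_ne by (auto simp: card_gt_0_iff)

lemma degree_P [simp]: "degree (P t) = card I"
  and degree_Q [simp]: "degree (Q t) = card K"
  and degree_B [simp]: "degree (B t k) = card (K - {k})"
  by (simp_all add: P_def Q_def B_def)

lemma degree_Pd: "degree (Pd t) \<le> card I - 1"
  and degree_Qd: "degree (Qd t) \<le> card K - 1"
  unfolding Pd_def Qd_def B_def by (rule degree_sum_linprod_remove)+

lemma
  assumes "0 \<le> t" "ereal t < T"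
  shows P_deriv: "has_poly_derivative (card I) P (Pd t) t {0..}"
    and Q_deriv: "has_poly_derivative (card K) Q (Qd t) t {0..}"
    and B_deriv: "has_poly_derivative (card (K - {k})) (\<lambda>s. B s k) (Bd t k) t {0..}"
proof -
  have x: "((\<lambda>s. x s i) has_vector_derivative x' t i) (at t within {0..})" if "i \<in> I" for i
    using x_deriv[OF assms that] by (simp only: x'_def)
  have \<zeta>: "((\<lambda>s. \<zeta> s k) has_vector_derivative \<zeta>' t k) (at t within {0..})" if "k \<in> K" for k
    using \<zeta>_deriv[OF assms that] by (simp only: \<zeta>'_def)
  show "has_poly_derivative (card I) P (Pd t) t {0..}"
    unfolding P_def Pd_def by (rule has_poly_derivative_linprod[OF finite_I x])
  show "has_poly_derivative (card K) Q (Qd t) t {0..}"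
    unfolding Q_def Qd_def B_def by (rule has_poly_derivative_linprod[OF finite_K \<zeta>])
  show "has_poly_derivative (card (K - {k})) (\<lambda>s. B s k) (Bd t k) t {0..}"
    unfolding B_def Bd_def using finite_K by (intro has_poly_derivative_linprod \<zeta>) auto
qed

lemma Q_eq: "k \<in> K \<Longrightarrow> Q t = [:- \<zeta> t k, 1:] * B t k"
  unfolding Q_def B_def by (rule linprod_remove[OF finite_K])

lemma Qd_eq:
  assumes "k \<in> K"
  shows "Qd t = [:- \<zeta> t k, 1:] * Bd t k - smult (\<zeta>' t k) (B t k)"
proof -
  have "B t l = [:- \<zeta> t k, 1:] * linprod (K - {k} - {l}) (\<zeta> t)" if "l \<in> K - {k}" for l
  proof -
    have "K - {k} - {l} = K - {l} - {k}" by auto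
    then show ?thesis
      using linprod_remove[of "K - {l}" k "\<zeta> t"] finite_K assms that by (auto simp: B_def simp del: mult_pCons_left)
  qed
  then have "(\<Sum>l\<in>K - {k}. smult (- \<zeta>' t l) (B t l)) = [:- \<zeta> t k, 1:] * Bd t k"
    unfolding Bd_def sum_distrib_left by (intro sum.cong refl) (simp del: mult_pCons_left)
  then show ?thesis
    using assms finite_K by (simp add: Qd_def sum.remove del: mult_pCons_left)
qed

text \<open>The values of \<open>Q\<close> and its derivatives come from
  \<open>Q = (z - \<zeta>) B\<close>. The last item says that the Loewner velocity of a marked point
  is half the logarithmic derivative of \<open>P\<close>.\<close>

lemma
  assumes "0 \<le> t" "ereal t < T"
  shows P_\<zeta>_nz: "k \<in> K \<Longrightarrow> poly (P t) (\<zeta> t k) \<noteq> 0"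
    and Q_x_nz: "i \<in> I \<Longrightarrow> poly (Q t) (x t i) \<noteq> 0"
    and B_\<zeta>_nz: "k \<in> K \<Longrightarrow> poly (B t k) (\<zeta> t k) \<noteq> 0"
    and Q_\<zeta>: "k \<in> K \<Longrightarrow> poly (Q t) (\<zeta> t k) = 0"
    and Q'_\<zeta>: "k \<in> K \<Longrightarrow> poly (pderiv (Q t)) (\<zeta> t k) = poly (B t k) (\<zeta> t k)"
    and Q''_\<zeta>: "k \<in> K \<Longrightarrow> poly (pderiv (pderiv (Q t))) (\<zeta> t k) = 2 * poly (pderiv (B t k)) (\<zeta> t k)"
    and Qd_\<zeta>: "k \<in> K \<Longrightarrow> poly (Qd t) (\<zeta> t k) = - \<zeta>' t k * poly (B t k) (\<zeta> t k)"
    and P'_\<zeta>: "k \<in> K \<Longrightarrow> poly (pderiv (P t)) (\<zeta> t k) = 2 * \<zeta>' t k * poly (P t) (\<zeta> t k)"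
proof -
  show "k \<in> K \<Longrightarrow> poly (P t) (\<zeta> t k) \<noteq> 0"
    using disjoint[OF assms, of _ k] finite_I by (force simp: P_def poly_linprod_eq_0_iff)
  show "i \<in> I \<Longrightarrow> poly (Q t) (x t i) \<noteq> 0"
    using disjoint[OF assms, of i] finite_K by (force simp: Q_def poly_linprod_eq_0_iff)
  show "k \<in> K \<Longrightarrow> poly (B t k) (\<zeta> t k) \<noteq> 0"
    using poly_linprod_remove_nonzero[OF finite_K inj_\<zeta>[OF assms]] by (simp add: B_def)
  show "k \<in> K \<Longrightarrow> poly (Q t) (\<zeta> t k) = 0"
    using finite_K by (auto simp: Q_def poly_linprod_eq_0_iff)
  show "k \<in> K \<Longrightarrow> poly (pderiv (Q t)) (\<zeta> t k) = poly (B t k) (\<zeta> t k)"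
    "k \<in> K \<Longrightarrow> poly (pderiv (pderiv (Q t))) (\<zeta> t k) = 2 * poly (pderiv (B t k)) (\<zeta> t k)"
    using finite_K by (simp_all add: Q_def B_def poly_pderiv_linprod_root poly_pderiv2_linprod_root)
  show "k \<in> K \<Longrightarrow> poly (Qd t) (\<zeta> t k) = - \<zeta>' t k * poly (B t k) (\<zeta> t k)"
    unfolding Qd_def B_def using finite_K by (subst poly_sum_linprod_remove) auto
  show "poly (pderiv (P t)) (\<zeta> t k) = 2 * \<zeta>' t k * poly (P t) (\<zeta> t k)" if "k \<in> K"
  proof -
    have "poly (pderiv (P t)) (\<zeta> t k) = poly (P t) (\<zeta> t k) * (\<Sum>i\<in>I. 1 / (\<zeta> t k - x t i))"
      unfolding P_def using disjoint[OF assms _ that] by (intro poly_pderiv_linprod finite_I) metis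
    also have "(\<Sum>i\<in>I. 1 / (\<zeta> t k - x t i)) = 2 * \<zeta>' t k"
      unfolding \<zeta>'_def sum_distrib_left by (intro sum.cong) (auto simp: divide_simps)
    finally show ?thesis by simp
  qed
qed

text \<open>This is \<open>\<partial>\<^sub>t (P / Q\<^sup>2) = - (P' / Q\<^sup>2)' / 2\<close> with the denominators cleared.\<close>

lemma continuity_equation:
  assumes "0 \<le> t" "ereal t < T"
  shows "2 * Q t * Pd t - 4 * P t * Qd t + pderiv (pderiv (P t)) * Q t
      - 2 * pderiv (P t) * pderiv (Q t) = 0" (is "?N = 0")
proof (rule poly_eqI_degree[where A = "x t ` I \<union> \<zeta> t ` K"])
  note nz = P_\<zeta>_nz[OF assms] Q_x_nz[OF assms] B_\<zeta>_nz[OF assms]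
  \<comment> \<open>The left-hand side has degree below \<open>card I + card K\<close>, so it is
    enough that it vanishes at all particles.\<close>
  show "poly ?N z = poly 0 z" if "z \<in> x t ` I \<union> \<zeta> t ` K" for z
    using that
  proof
    assume "z \<in> x t ` I"
    then obtain i where i: "i \<in> I" and z: "z = x t i" by auto
    \<comment> \<open>At a driving point \<open>P\<close> vanishes and what remains is
      \<open>2 * (- x' * L * Q + L' * Q - L * Q')\<close>, which is 0 by the equation for the
      velocity \<open>x'\<close>.\<close>
    define L where "L = linprod (I - {i}) (x t)"
    have inj: "inj_on (x t) I" by (rule inj_x[OF assms])
    have 1: "poly (P t) z = 0"
      using i finite_I by (auto simp: P_def z poly_linprod_eq_0_iff)
    have 2: "poly (pderiv (P t)) z = poly L z" "poly (pderiv (pderiv (P t))) z = 2 * poly (pderiv L) z"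
      using i finite_I by (simp_all add: P_def L_def z poly_pderiv_linprod_root poly_pderiv2_linprod_root)
    have 3: "poly (pderiv L) z = poly L z * (\<Sum>j\<in>I - {i}. 1 / (z - x t j))"
      unfolding L_def using inj i finite_I by (intro poly_pderiv_linprod) (auto simp: z dest: inj_onD)
    have 4: "poly (pderiv (Q t)) z = poly (Q t) z * (\<Sum>k\<in>K. 1 / (z - \<zeta> t k))"
      unfolding Q_def using i finite_K disjoint[OF assms i] by (intro poly_pderiv_linprod) (auto simp: z)
    have 5: "poly (Pd t) z = - x' t i * poly L z"
      unfolding Pd_def L_def z using i finite_I by (subst poly_sum_linprod_remove) auto
    show ?thesis
      by (simp add: 1 2 3 4 5) (simp add: x'_def z algebra_simps)
  next
    assume "z \<in> \<zeta> t ` K"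
    then obtain k where k: "k \<in> K" and z: "z = \<zeta> t k" by auto
    \<comment> \<open>At a marked point \<open>Q\<close> vanishes, and
      \<open>- 4 * P * Qd = 4 * P * \<zeta>' * B\<close> cancels \<open>- 2 * P' * B\<close> because
      \<open>P' = 2 * \<zeta>' * P\<close>.\<close>
    show ?thesis
      unfolding z using k by (simp add: Q_\<zeta>[OF assms] Q'_\<zeta>[OF assms] Qd_\<zeta>[OF assms] P'_\<zeta>[OF assms])
  qed
  have "card (x t ` I \<union> \<zeta> t ` K) = card I + card K"
    using finite_I finite_K inj_x[OF assms] inj_\<zeta>[OF assms] disjoint[OF assms]
    by (subst card_Un_disjoint) (auto simp: card_image)
  moreover have "degree ?N \<le> card I + card K - 1"
  proof -
    have num: "degree (2 * p) \<le> degree p" "degree (4 * p) \<le> degree p" for p :: "complex poly"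
      by (simp_all add: numeral_poly)
    have "degree (2 * Q t * Pd t) \<le> card K + (card I - 1)" "degree (4 * P t * Qd t) \<le> card I + (card K - 1)"
      "degree (pderiv (pderiv (P t)) * Q t) \<le> card I - 1 - 1 + card K"
      "degree (2 * pderiv (P t) * pderiv (Q t)) \<le> card I - 1 + (card K - 1)"
      by (intro order.trans[OF degree_mult_le] add_mono order.trans[OF num(1)] order.trans[OF num(2)] degree_Pd degree_Qd;
          simp add: degree_pderiv)+
    then show ?thesis
      using card_pos by (intro degree_diff_le degree_add_le) linarith+
  qed
  ultimately show "degree ?N < card (x t ` I \<union> \<zeta> t ` K)" "degree (0 :: complex poly) < card (x t ` I \<union> \<zeta> t ` K)"
    using card_pos by simp_all
qed

end

section \<open>The stationary case\<close>

text \<open>Makes derivatives within \<open>{0..}\<close> unique, also at the endpoint 0.\<close>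

lemma at_within_Ici_neq_bot: "0 \<le> t \<Longrightarrow> at t within {0::real..} \<noteq> bot"
proof -
  assume "0 \<le> t"
  then have "t islimpt {t..t+1}" by (simp add: islimpt_Icc)
  then have "t islimpt {0..}" by (rule islimpt_subset) (use \<open>0 \<le> t\<close> in auto)
  then show ?thesis by (simp add: trivial_limit_within)
qed

lemma eventually_before_lifetime:
  assumes "0 \<le> t" "ereal t < T"
  shows "\<forall>\<^sub>F s in at t within {0..}. 0 \<le> s \<and> ereal s < T"
proof -
  have "((\<lambda>s. ereal s) \<longlongrightarrow> ereal t) (at t within {0..})"
    by (rule tendsto_ereal[OF tendsto_ident_at])
  then have "\<forall>\<^sub>F s in at t within {0..}. ereal s < T"
    using assms(2) by (rule order_tendstoD(2))
  moreover have "\<forall>\<^sub>F s in at t within {0..}. s \<in> {0..}"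
    by (simp add: eventually_at_filter)
  ultimately show ?thesis by eventually_elim auto
qed

lemma has_vector_derivative_transform_eventually:
  assumes "(f has_vector_derivative f') (at t within S)" "\<forall>\<^sub>F s in at t within S. f s = g s"
    "f t = g t" "t \<in> S"
  shows "(g has_vector_derivative f') (at t within S)"
  using assms unfolding has_vector_derivative_def by (rule has_derivative_transform_eventually)

text \<open>Allows a polynomial identity valid at all times before \<open>T\<close> to be
  differentiated in time; the two sides may carry different degree bounds.\<close>

lemma has_poly_derivative_unique:
  assumes t: "0 \<le> t" "ereal t < T"
    and p: "has_poly_derivative d p p' t {0..}" and q: "has_poly_derivative e q q' t {0..}"
    and eq: "\<And>s. 0 \<le> s \<Longrightarrow> ereal s < T \<Longrightarrow> p s = q s"
  shows "p' = q'"
proof (rule poly_eqI)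
  fix i
  have "((\<lambda>s. coeff (q s) i) has_vector_derivative coeff q' i) (at t within {0..})"
    using q by (simp add: has_poly_derivative_def)
  moreover have "((\<lambda>s. coeff (q s) i) has_vector_derivative coeff p' i) (at t within {0..})"
  proof (rule has_vector_derivative_transform_eventually)
    show "((\<lambda>s. coeff (p s) i) has_vector_derivative coeff p' i) (at t within {0..})"
      using p by (simp add: has_poly_derivative_def)
    show "\<forall>\<^sub>F s in at t within {0..}. coeff (p s) i = coeff (q s) i"
      using eventually_before_lifetime[OF t] by eventually_elim (simp add: eq)
  qed (use t eq in auto)
  ultimately show "coeff p' i = coeff q' i"
    using vector_derivative_unique_within at_within_Ici_neq_bot[OF t(1)] by metis
qed

text \<open>The relation at time 0 is the stationary relation cleared of denominators:
  \<open>P / Q^2\<close> has no residue at a marked point. The bound on \<open>card I\<close> keeps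
  \<open>P / Q^2\<close> bounded near infinity.\<close>

locale stationary_flow = particle_flow +
  assumes T_pos: "0 < T" and card_I_le: "card I \<le> 2 * card K"
    and stationary_0: "k \<in> K \<Longrightarrow> poly (pderiv (P 0)) (\<zeta> 0 k) * poly (B 0 k) (\<zeta> 0 k)
      = 2 * poly (P 0) (\<zeta> 0 k) * poly (pderiv (B 0 k)) (\<zeta> 0 k)"
begin

lemma stationary:
  assumes "0 \<le> t" "ereal t < T" "k \<in> K"
  shows "poly (pderiv (P t)) (\<zeta> t k) * poly (B t k) (\<zeta> t k)
      = 2 * poly (P t) (\<zeta> t k) * poly (pderiv (B t k)) (\<zeta> t k)"
proof -
  define U where "U s = pderiv (P s) * B s k - 2 * (P s * pderiv (B s k))" for s
  \<comment> \<open>The residue of \<open>P / Q^2\<close> at \<open>\<zeta> s k\<close>, that is the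
    derivative of \<open>P / B^2\<close> there.\<close>
  define r where "r s = poly (U s) (\<zeta> s k) / poly (B s k) (\<zeta> s k) ^ 3" for s
  have r': "(r has_vector_derivative 0) (at s within {0..t})" if "s \<in> {0..t}" for s
  proof -
    have s: "0 \<le> s" "ereal s < T" using that assms(2) by (auto intro: order.strict_trans1[of _ "ereal t"])
    define b where "b = poly (B s k) (\<zeta> s k)"
    have b: "b \<noteq> 0" using B_\<zeta>_nz[OF s assms(3)] by (simp add: b_def)
    have \<zeta>: "((\<lambda>s. \<zeta> s k) has_vector_derivative \<zeta>' s k) (at s within {0..})"
      using \<zeta>_deriv[OF s assms(3)] by (simp only: \<zeta>'_def)
    define Ud where "Ud = pderiv (Pd s) * B s k + pderiv (P s) * Bd s k
        - 2 * (Pd s * pderiv (B s k) + P s * pderiv (Bd s k))"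
    have "has_poly_derivative (card I + card (K - {k})) U Ud s {0..}"
      unfolding U_def Ud_def
      using has_poly_derivative_diff[OF
          has_poly_derivative_mult[OF has_poly_derivative_pderiv[OF P_deriv[OF s]] B_deriv[OF s, of k]]
          has_poly_derivative_mono[OF has_poly_derivative_mult[OF has_poly_derivative_const[of 2 0]
            has_poly_derivative_mult[OF P_deriv[OF s] has_poly_derivative_pderiv[OF B_deriv[OF s, of k]]]]]]
      by simp
    from has_vector_derivative_poly_moving[OF this \<zeta>]
    have U': "((\<lambda>s. poly (U s) (\<zeta> s k)) has_vector_derivative
        poly (Ud + smult (\<zeta>' s k) (pderiv (U s))) (\<zeta> s k)) (at s within {0..})"
      by (simp add: mult.commute)
    have B': "((\<lambda>s. poly (B s k) (\<zeta> s k)) has_vector_derivative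
        poly (Bd s k + smult (\<zeta>' s k) (pderiv (B s k))) (\<zeta> s k)) (at s within {0..})"
      using has_vector_derivative_poly_moving[OF B_deriv[OF s, of k] \<zeta>] by (simp add: mult.commute)
    have "2 * ([:- \<zeta> s k, 1:] * B s k) * Pd s - 4 * P s * ([:- \<zeta> s k, 1:] * Bd s k - smult (\<zeta>' s k) (B s k))
        + pderiv (pderiv (P s)) * ([:- \<zeta> s k, 1:] * B s k)
        - 2 * pderiv (P s) * pderiv ([:- \<zeta> s k, 1:] * B s k) = 0"
      using continuity_equation[OF s] unfolding Qd_eq[OF assms(3)] Q_eq[OF assms(3)] .
    from residue_conserved[OF this B_\<zeta>_nz[OF s assms(3)]]
    have key: "poly (Ud + smult (\<zeta>' s k) (pderiv (U s))) (\<zeta> s k) * b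
        = 3 * poly (U s) (\<zeta> s k) * poly (Bd s k + smult (\<zeta>' s k) (pderiv (B s k))) (\<zeta> s k)"
      by (simp only: Ud_def U_def b_def mult.assoc)
    have "(r has_vector_derivative
       (poly (Ud + smult (\<zeta>' s k) (pderiv (U s))) (\<zeta> s k) * b ^ 3 - poly (U s) (\<zeta> s k) *
         (of_nat 3 * b ^ (3 - 1) * poly (Bd s k + smult (\<zeta>' s k) (pderiv (B s k))) (\<zeta> s k))) / (b ^ 3)\<^sup>2)
       (at s within {0..})"
      unfolding r_def b_def
      by (rule has_vector_derivative_quotient[OF U' has_vector_derivative_power_complex[OF B']])
         (use b in \<open>simp add: b_def\<close>)
    \<comment> \<open>The numerator is \<open>b^2\<close> times the difference of the two sides of
      \<open>key\<close>.\<close>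
    also have "poly (Ud + smult (\<zeta>' s k) (pderiv (U s))) (\<zeta> s k) * b ^ 3 - poly (U s) (\<zeta> s k) *
         (of_nat 3 * b ^ (3 - 1) * poly (Bd s k + smult (\<zeta>' s k) (pderiv (B s k))) (\<zeta> s k))
      = (poly (Ud + smult (\<zeta>' s k) (pderiv (U s))) (\<zeta> s k) * b
        - 3 * poly (U s) (\<zeta> s k) * poly (Bd s k + smult (\<zeta>' s k) (pderiv (B s k))) (\<zeta> s k)) * b\<^sup>2"
    proof -
      have "u * b ^ 3 - v * (of_nat 3 * b ^ (3 - 1) * w) = (u * b - 3 * v * w) * b\<^sup>2" for u v w :: complex
        by (simp add: power3_eq_cube power2_eq_square algebra_simps)
      then show ?thesis .
    qed
    also have "\<dots> = 0" unfolding key by simp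
    finally show ?thesis by (auto intro: has_vector_derivative_within_subset)
  qed
  obtain e where e: "\<And>s. s \<in> {0..t} \<Longrightarrow> r s = e"
    using has_vector_derivative_zero_constant[OF convex_real_interval(5) r'] by metis
  have "r t = r 0" using e[of t] e[of 0] assms(1) by simp
  also have "r 0 = 0" using stationary_0[OF assms(3)] by (simp add: r_def U_def)
  finally show ?thesis using B_\<zeta>_nz[OF assms] by (simp add: r_def U_def)
qed

text \<open>Insert \<open>P' = 2 * \<zeta>' * P\<close> into the stationary relation and cancel
  \<open>P\<close>. Since \<open>B' / B\<close> is a sum of simple fractions, this is the velocity
  \<open>\<Sum> 1 / (\<zeta>_k - \<zeta>_l)\<close>.\<close>

lemma \<zeta>'_eq:
  assumes "0 \<le> t" "ereal t < T" "k \<in> K"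
  shows "\<zeta>' t k * poly (B t k) (\<zeta> t k) = poly (pderiv (B t k)) (\<zeta> t k)"
  using stationary[OF assms] P'_\<zeta>[OF assms] P_\<zeta>_nz[OF assms] by (simp add: mult_ac)

text \<open>Both sides have degree below \<open>card K\<close>, and at a marked point they are
  \<open>- \<zeta>' * B\<close> and \<open>- B'\<close>.\<close>

lemma backward_heat:
  assumes "0 \<le> t" "ereal t < T"
  shows "Qd t = smult (- (1/2)) (pderiv (pderiv (Q t)))"
proof -
  have "Qd t - smult (- (1/2)) (pderiv (pderiv (Q t))) = 0"
  proof (rule poly_0_if_roots[OF inj_\<zeta>[OF assms]])
    show "poly (Qd t - smult (- (1/2)) (pderiv (pderiv (Q t)))) (\<zeta> t k) = 0" if "k \<in> K" for k
      using that \<zeta>'_eq[OF assms that] by (simp add: Qd_\<zeta>[OF assms] Q''_\<zeta>[OF assms])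
    have "degree (Qd t - smult (- (1/2)) (pderiv (pderiv (Q t)))) \<le> card K - 1"
      using degree_Qd[of t] by (intro degree_diff_le) (auto simp: degree_pderiv)
    then show "degree (Qd t - smult (- (1/2)) (pderiv (pderiv (Q t)))) < card K"
      using card_pos by simp
  qed
  then show ?thesis by (simp only: right_minus_eq)
qed

section \<open>The rational function with derivative \<open>c P / Q^2\<close>\<close>

text \<open>\<open>num c G t / Q t\<close> is the sum of the polynomial \<open>G\<close> and the simple fractions whose derivative
  has the same double poles as \<open>c P / Q\<^sup>2\<close>.\<close>

definition res where "res c t k = - c * poly (P t) (\<zeta> t k) / (poly (B t k) (\<zeta> t k))\<^sup>2"
definition frac_num where "frac_num c t = (\<Sum>k\<in>K. smult (res c t k) (B t k))"
definition num where "num c G t = G * Q t + frac_num c t"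

lemma degree_frac_num: "degree (frac_num c t) \<le> card K - 1"
  unfolding frac_num_def B_def by (rule degree_sum_linprod_remove)

text \<open>This is \<open>A' * Q - A * Q' = c * P\<close> at a root of \<open>Q\<close>, with
  \<open>A\<close> the numerator; \<open>res\<close> is chosen to make it true.\<close>

lemma num_\<zeta>:
  assumes "0 \<le> t" "ereal t < T" "k \<in> K"
  shows "poly (num c G t) (\<zeta> t k) * poly (B t k) (\<zeta> t k) = - c * poly (P t) (\<zeta> t k)"
proof -
  have "poly (frac_num c t) (\<zeta> t k) = res c t k * poly (B t k) (\<zeta> t k)"
    unfolding frac_num_def B_def using assms(3) finite_K by (subst poly_sum_linprod_remove) auto
  then show ?thesis
    using B_\<zeta>_nz[OF assms] by (simp add: num_def Q_\<zeta>[OF assms] res_def power2_eq_square)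
qed

text \<open>Only the existence of a time derivative is recorded; \<open>num_deriv\<close> identifies
  it through the Wronskian.\<close>

lemma frac_num_deriv:
  assumes "0 \<le> t" "ereal t < T"
  obtains D where "has_poly_derivative (card K - 1) (frac_num c) D t {0..}"
proof -
  have "\<exists>a'. ((\<lambda>s. res c s k) has_vector_derivative a') (at t within {0..})" if "k \<in> K" for k
  proof -
    have \<zeta>: "((\<lambda>s. \<zeta> s k) has_vector_derivative \<zeta>' t k) (at t within {0..})"
      using \<zeta>_deriv[OF assms that] by (simp only: \<zeta>'_def)
    show ?thesis
      unfolding res_def
      using has_vector_derivative_quotient[OF
          has_vector_derivative_mult_right[OF has_vector_derivative_poly_moving[OF P_deriv[OF assms] \<zeta>]]
          has_vector_derivative_power_complex[OF has_vector_derivative_poly_moving[OF B_deriv[OF assms, of k] \<zeta>]],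
          of 2 "- c"] B_\<zeta>_nz[OF assms that]
      by (intro exI) auto
  qed
  then obtain a' where a': "\<And>k. k \<in> K \<Longrightarrow> ((\<lambda>s. res c s k) has_vector_derivative a' k) (at t within {0..})"
    by metis
  have "has_poly_derivative (card K - 1) (frac_num c)
      (\<Sum>k\<in>K. smult (res c t k) (Bd t k) + smult (a' k) (B t k)) t {0..}"
    unfolding frac_num_def
  proof (intro has_poly_derivative_sum has_poly_derivative_smult a')
    fix k assume "k \<in> K"
    then have "card (K - {k}) = card K - 1" using finite_K by simp
    then show "has_poly_derivative (card K - 1) (\<lambda>s. B s k) (Bd t k) t {0..}"
      using B_deriv[OF assms, of k] by (simp only:)
  qed
  then show ?thesis by (rule that)
qed

text \<open>Divided by \<open>Q^2\<close> this reads \<open>(num / Q)' = c * P / Q^2\<close>. The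
  difference \<open>W\<close> of the two sides has degree below \<open>2 * card K\<close> and a
  double zero at each marked point: its value vanishes by the choice of the residues, its derivative
  by the stationary relation.\<close>

lemma wronskian:
  assumes t: "0 \<le> t" "ereal t < T" and G: "pderiv G = [:\<kappa>:]"
    and w0: "pderiv (num c G 0) * Q 0 - num c G 0 * pderiv (Q 0) = smult c (P 0)"
  shows "pderiv (num c G t) * Q t - num c G t * pderiv (Q t) = smult c (P t)"
proof -
  define W where "W s = pderiv (num c G s) * Q s - num c G s * pderiv (Q s) - smult c (P s)" for s
  define E where "E s = pderiv (frac_num c s) * Q s - frac_num c s * pderiv (Q s)" for s
  have W: "W s = smult \<kappa> (Q s * Q s) + E s - smult c (P s)" for s
    by (simp add: W_def num_def E_def pderiv_add pderiv_mult G algebra_simps)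
  have E: "degree (E s) < 2 * card K" for s
  proof -
    have "degree (E s) \<le> 2 * card K - 1"
      unfolding E_def using degree_frac_num[of c s] card_pos
      by (intro degree_diff_le order.trans[OF degree_mult_le]) (auto simp: degree_pderiv)
    then show ?thesis using card_pos by linarith
  qed
  \<comment> \<open>The coefficient of degree \<open>2 * card K\<close> does not depend on time, so
    it is 0 because it is 0 initially.\<close>
  have coeff_W: "coeff (W s) (2 * card K) = \<kappa> - c * (if card I = 2 * card K then 1 else 0)" for s
  proof -
    have "coeff (Q s * Q s) (2 * card K) = 1"
      using coeff_mult_degree_sum[of "Q s" "Q s"] by (simp add: Q_def mult_2)
    moreover have "coeff (P s) (2 * card K) = (if card I = 2 * card K then 1 else 0)"
    proof (cases "card I = 2 * card K")
      case True
      then show ?thesis unfolding P_def using lead_coeff_linprod[of I "x s"] by simp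
    next
      case False
      then show ?thesis using card_I_le by (simp add: coeff_eq_0)
    qed
    ultimately show ?thesis using coeff_eq_0[OF E] by (simp add: W)
  qed
  have "W 0 = 0" using w0 by (simp add: W_def)
  then have "coeff (W t) (2 * card K) = 0" using coeff_W[of t] coeff_W[of 0] by simp
  moreover have "degree (W t) \<le> 2 * card K"
    unfolding W using E[of t] card_I_le
    by (intro degree_diff_le degree_add_le order.trans[OF degree_smult_le] order.trans[OF degree_mult_le]) auto
  ultimately have "degree (W t) < 2 * card K"
    using card_pos by (intro degree_less_if_coeff_0) auto
  moreover have "poly (W t) (\<zeta> t k) = 0" if "k \<in> K" for k
    using num_\<zeta>[OF t that, of c G] by (simp add: W_def Q_\<zeta>[OF t that] Q'_\<zeta>[OF t that])
  moreover have "poly (pderiv (W t)) (\<zeta> t k) = 0" if "k \<in> K" for k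
  proof -
    have "poly (pderiv (W t)) (\<zeta> t k) = - poly (num c G t) (\<zeta> t k) * (2 * poly (pderiv (B t k)) (\<zeta> t k))
        - c * poly (pderiv (P t)) (\<zeta> t k)"
      by (simp add: W_def pderiv_diff pderiv_mult pderiv_smult Q_\<zeta>[OF t that] Q''_\<zeta>[OF t that])
    then have "poly (pderiv (W t)) (\<zeta> t k) * poly (B t k) (\<zeta> t k) = 0"
      using num_\<zeta>[OF t that, of c G] stationary[OF t that] by algebra
    then show ?thesis using B_\<zeta>_nz[OF t that] by simp
  qed
  ultimately have "W t = 0"
    using poly_0_if_double_roots[OF inj_\<zeta>[OF t] finite_K] by blast
  then show ?thesis by (simp add: W_def)
qed

text \<open>The second property says that \<open>num / Q\<close> has time derivative
  \<open>- c * P' / (2 * Q^2)\<close>. By the Wronskian differentiated in time and the continuity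
  equation, both functions have the same \<open>z\<close>-derivative, and their difference vanishes
  at infinity since \<open>G\<close> is constant in time.\<close>

lemma num_deriv:
  assumes t: "0 \<le> t" "ereal t < T" and G: "pderiv G = [:\<kappa>:]"
    and w0: "pderiv (num c G 0) * Q 0 - num c G 0 * pderiv (Q 0) = smult c (P 0)"
  obtains d D where "has_poly_derivative d (num c G) D t {0..}"
    "D * Q t - num c G t * Qd t = smult (- (c/2)) (pderiv (P t))"
proof -
  obtain L where L: "has_poly_derivative (card K - 1) (frac_num c) L t {0..}"
    using frac_num_deriv[OF t] by blast
  define d where "d = degree G + card K"
  define D where "D = G * Qd t + L"
  define A where "A = num c G"
  have A: "has_poly_derivative d A D t {0..}"
    unfolding A_def num_def d_def D_def
    using has_poly_derivative_add[OF has_poly_derivative_mult[OF has_poly_derivative_const[OF order_refl, of G]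
          Q_deriv[OF t]] has_poly_derivative_mono[OF L]] by simp
  have wr: "pderiv (A s) * Q s - A s * pderiv (Q s) = smult c (P s)" if "0 \<le> s" "ereal s < T" for s
    unfolding A_def by (rule wronskian[OF that G w0])
  have "has_poly_derivative (d + card K) (\<lambda>s. pderiv (A s) * Q s - A s * pderiv (Q s))
      (pderiv D * Q t + pderiv (A t) * Qd t - (D * pderiv (Q t) + A t * pderiv (Qd t))) t {0..}"
    by (intro has_poly_derivative_diff has_poly_derivative_mult has_poly_derivative_pderiv A Q_deriv t)
  moreover have "has_poly_derivative (card I) (\<lambda>s. smult c (P s)) (smult c (Pd t)) t {0..}"
    using has_poly_derivative_smult[OF has_vector_derivative_const P_deriv[OF t], of c] by simp
  ultimately have wr_t:
    "pderiv D * Q t + pderiv (A t) * Qd t - (D * pderiv (Q t) + A t * pderiv (Qd t)) = smult c (Pd t)"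
    by (rule has_poly_derivative_unique[OF t _ _ wr])
  define W where "W = D * Q t - A t * Qd t + smult (c/2) (pderiv (P t))"
  have "W = 0"
  proof (rule eq_0_if_pderiv_over_square_0)
    \<comment> \<open>The scalar \<open>c/2\<close> becomes a constant polynomial, so that the
      identity below lives in the polynomial ring.\<close>
    define h where "h = [:c/2:]"
    have c: "smult c p = 2 * h * p" "smult (c/2) p = h * p" for p
      by (simp_all add: h_def numeral_poly)
    have h': "pderiv h = 0" by (simp add: h_def pderiv_pCons)
    note ce = continuity_equation[OF t]
    have W': "pderiv W = pderiv D * Q t + D * pderiv (Q t) - pderiv (A t) * Qd t - A t * pderiv (Qd t)
        + h * pderiv (pderiv (P t))"
      unfolding W_def c by (simp add: pderiv_add pderiv_diff pderiv_mult h' algebra_simps)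
    \<comment> \<open>Given \<open>wr_t\<close> and the Wronskian, the difference of the two sides
      is \<open>h\<close> times the continuity equation.\<close>
    show "pderiv W * Q t = 2 * W * pderiv (Q t)"
      using ce wr_t wr[OF t] unfolding W' unfolding W_def c by algebra
    \<comment> \<open>The terms containing \<open>G\<close> cancel, which brings the degree below
      \<open>2 * card K\<close>.\<close>
    have "W = L * Q t - frac_num c t * Qd t + smult (c/2) (pderiv (P t))"
      by (simp add: W_def D_def A_def num_def algebra_simps)
    moreover have "degree \<dots> \<le> 2 * card K - 1"
      using degree_frac_num[of c t] has_poly_derivative_degree(1)[OF L] degree_Qd[of t] card_pos card_I_le
      by (intro degree_diff_le degree_add_le order.trans[OF degree_smult_le] order.trans[OF degree_mult_le])
         (auto simp: degree_pderiv)
    ultimately show "degree W < 2 * degree (Q t)"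
      using card_pos by simp
  qed
  then have "D * Q t - A t * Qd t = smult (- (c/2)) (pderiv (P t))"
    unfolding W_def by (simp add: eq_neg_iff_add_eq_0)
  then show ?thesis using that A by (simp add: A_def)
qed

text \<open>The term with \<open>z'\<close> comes from the Wronskian, the other one from
  \<open>num_deriv\<close>. A constant \<open>z\<close> gives the time derivative at a fixed point,
  a Loewner trajectory gives 0.\<close>

lemma num_over_Q_deriv:
  assumes t: "0 \<le> t" "ereal t < T" and G: "pderiv G = [:\<kappa>:]"
    and w0: "pderiv (num c G 0) * Q 0 - num c G 0 * pderiv (Q 0) = smult c (P 0)"
    and z: "(z has_vector_derivative z') (at t within {0..})" and nz: "poly (Q t) (z t) \<noteq> 0"
  shows "((\<lambda>s. poly (num c G s) (z s) / poly (Q s) (z s)) has_vector_derivative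
      c * (poly (P t) (z t) * z' - poly (pderiv (P t)) (z t) / 2) / (poly (Q t) (z t))\<^sup>2) (at t within {0..})"
proof -
  obtain d D where D: "has_poly_derivative d (num c G) D t {0..}"
    and e: "D * Q t - num c G t * Qd t = smult (- (c/2)) (pderiv (P t))"
    using num_deriv[OF t G w0] by blast
  note w = wronskian[OF t G w0]
  have "poly (D * Q t - num c G t * Qd t) (z t) = - (c/2) * poly (pderiv (P t)) (z t)"
    "poly (pderiv (num c G t) * Q t - num c G t * pderiv (Q t)) (z t) = c * poly (P t) (z t)"
    unfolding e w by simp_all
  then have "(poly D (z t) + poly (pderiv (num c G t)) (z t) * z') * poly (Q t) (z t)
      - poly (num c G t) (z t) * (poly (Qd t) (z t) + poly (pderiv (Q t)) (z t) * z')
    = c * (poly (P t) (z t) * z' - poly (pderiv (P t)) (z t) / 2)"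
    by simp algebra
  then show ?thesis
    using has_vector_derivative_quotient[OF has_vector_derivative_poly_moving[OF D z]
        has_vector_derivative_poly_moving[OF Q_deriv[OF t] z] nz] by simp
qed

end

section \<open>Rational functions\<close>

text \<open>\<open>f\<close> is known off the roots of \<open>Q\<close>; this set is open, so
  derivatives there are determined, and the Wronskian supplies the numerator of the quotient
  rule.\<close>

lemma
  fixes A Q P :: "complex poly"
  assumes w: "pderiv A * Q - A * pderiv Q = smult c P"
    and f: "\<And>z. poly Q z \<noteq> 0 \<Longrightarrow> f z = poly A z / poly Q z" and nz: "poly Q z \<noteq> 0"
  shows deriv_rational: "deriv f z = c * poly P z / (poly Q z)\<^sup>2"
    and deriv2_rational: "deriv (deriv f) z
      = c * (poly (pderiv P) z * poly Q z - 2 * poly P z * poly (pderiv Q) z) / poly Q z ^ 3"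
proof -
  have ev: "\<forall>\<^sub>F u in nhds z. poly Q u \<noteq> 0" if "poly Q z \<noteq> 0" for z
    using that eventually_nhds_in_open[of "{u. poly Q u \<noteq> 0}" z]
    by (simp add: open_Collect_neq continuous_on_poly)
  have d1: "deriv f z = c * poly P z / (poly Q z)\<^sup>2" if nz: "poly Q z \<noteq> 0" for z
  proof -
    have "deriv f z = deriv (\<lambda>z. poly A z / poly Q z) z"
      by (rule deriv_cong_ev[OF eventually_mono[OF ev[OF nz]] refl]) (rule f)
    also have "\<dots> = (poly (pderiv A) z * poly Q z - poly A z * poly (pderiv Q) z) / (poly Q z * poly Q z)"
      using nz by (intro DERIV_imp_deriv DERIV_divide poly_DERIV)
    also have "poly (pderiv A) z * poly Q z - poly A z * poly (pderiv Q) z = c * poly P z"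
      using arg_cong[OF w, of "\<lambda>p. poly p z"] by simp
    finally show ?thesis by (simp add: power2_eq_square)
  qed
  then show "deriv f z = c * poly P z / (poly Q z)\<^sup>2" using nz by blast
  have "deriv (deriv f) z = deriv (\<lambda>z. poly (smult c P) z / poly (Q * Q) z) z"
    by (rule deriv_cong_ev[OF eventually_mono[OF ev[OF nz]] refl]) (simp add: d1 power2_eq_square)
  also have "\<dots> = (poly (pderiv (smult c P)) z * poly (Q * Q) z - poly (smult c P) z * poly (pderiv (Q * Q)) z)
      / (poly (Q * Q) z * poly (Q * Q) z)"
    using nz by (intro DERIV_imp_deriv DERIV_divide poly_DERIV) simp
  also have "\<dots> = c * (poly (pderiv P) z * poly Q z - 2 * poly P z * poly (pderiv Q) z) / poly Q z ^ 3"
    using nz by (simp add: pderiv_mult pderiv_smult divide_simps power3_eq_cube) (simp add: algebra_simps)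
  finally show "deriv (deriv f) z
      = c * (poly (pderiv P) z * poly Q z - 2 * poly P z * poly (pderiv Q) z) / poly Q z ^ 3" .
qed

lemma coprime_poly_no_common_root:
  fixes p q :: "'a :: {field_gcd} poly"
  assumes "coprime p q" "poly p z = 0"
  shows "poly q z \<noteq> 0"
proof
  assume "poly q z = 0"
  then have "[:- z, 1:] dvd 1"
    using assms by (intro coprime_common_divisor[of p q]) (simp_all add: poly_eq_0_iff_dvd)
  then show False by (simp add: is_unit_iff_degree)
qed

lemma rat_cross:
  assumes "Q \<noteq> 0"
  shows "poly (rat_num (Fract A Q)) z * poly Q z = poly A z * poly (rat_den (Fract A Q)) z"
proof -
  have "Fract (rat_num (Fract A Q)) (rat_den (Fract A Q)) = Fract A Q"
    by (simp add: rat_num_def rat_den_def)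
  then have "rat_num (Fract A Q) * Q = A * rat_den (Fract A Q)"
    using assms by (simp add: eq_fract rat_den_def)
  then show ?thesis by (metis poly_mult)
qed

lemma rat_num_nz_at_pole: "poly (rat_den R) z = 0 \<Longrightarrow> poly (rat_num R) z \<noteq> 0"
  using coprime_poly_no_common_root[of "rat_den R" "rat_num R" z] coprime_quot_of_fract[of R]
  by (simp add: rat_num_def rat_den_def coprime_commute)

text \<open>By \<open>rat_cross\<close>, a zero of the reduced denominator off the roots of
  \<open>Q\<close> would also be a zero of the reduced numerator, against coprimality.\<close>

lemma
  assumes "poly Q z \<noteq> 0"
  shows rat_den_Fract_nz: "poly (rat_den (Fract A Q)) z \<noteq> 0"
    and rat_eval_Fract: "rat_eval (Fract A Q) z = poly A z / poly Q z"
proof -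
  have Q: "Q \<noteq> 0" using assms by auto
  show "poly (rat_den (Fract A Q)) z \<noteq> 0"
    using rat_cross[OF Q, of A z] rat_num_nz_at_pole[of "Fract A Q" z] assms by auto
  then show "rat_eval (Fract A Q) z = poly A z / poly Q z"
    using rat_cross[OF Q, of A z] assms by (simp add: rat_eval_def divide_simps)
qed

lemma rat_map_Fract:
  assumes "Q \<noteq> 0" "poly Q z = 0 \<Longrightarrow> poly A z \<noteq> 0"
  shows "rat_map (Fract A Q) (Some z) = (if poly Q z = 0 then None else Some (poly A z / poly Q z))"
  using rat_cross[OF assms(1), of A z] assms(2) rat_den_Fract_nz[of Q z A] rat_eval_Fract[of Q z A]
  by (cases "poly Q z = 0") simp_all

section \<open>The evolution of a given rational function\<close>

context stationary_flow
begin

text \<open>Write \<open>A = G * Q 0 + L\<close> by division. The Wronskian of \<open>A\<close> and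
  \<open>Q 0\<close> has degree at most \<open>card I\<close> and vanishes at the critical points,
  so it is \<open>c * P 0\<close>. Its values at the marked points show that \<open>c\<close> is
  nonzero and that \<open>L\<close> equals \<open>frac_num\<close>.\<close>

lemma initial_data:
  fixes A :: "complex poly"
  assumes crit: "\<And>i. i \<in> I \<Longrightarrow> poly (pderiv A * Q 0 - A * pderiv (Q 0)) (x 0 i) = 0"
    and A_\<zeta>: "\<And>k. k \<in> K \<Longrightarrow> poly A (\<zeta> 0 k) \<noteq> 0"
    and deg: "degree A \<le> card K + 1" "card K < degree A \<Longrightarrow> card I = 2 * card K" "2 * card K \<le> card I + 2"
  obtains c G \<kappa> where "c \<noteq> 0" "pderiv G = [:\<kappa>:]" "num c G 0 = A"
    "pderiv (num c G 0) * Q 0 - num c G 0 * pderiv (Q 0) = smult c (P 0)"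
proof -
  have 0: "0 \<le> (0::real)" "ereal 0 < T" using T_pos by (simp_all flip: zero_ereal_def)
  define G where "G = A div Q 0"
  define L where "L = A mod Q 0"
  define W where "W = pderiv A * Q 0 - A * pderiv (Q 0)"
  have Q_nz: "Q 0 \<noteq> 0" by (simp add: Q_def)
  have A: "A = G * Q 0 + L" by (simp add: G_def L_def)
  have L: "degree L \<le> card K - 1"
    using degree_mod_less'[of "Q 0" A] Q_nz by (cases "L = 0") (auto simp: L_def)
  have dG: "degree G + card K \<le> max (degree A) (card K)"
  proof (cases "G = 0")
    case False
    have "degree G + card K = degree (G * Q 0)" using False Q_nz by (simp add: degree_mult_eq)
    also have "G * Q 0 = A - L" using A by simp
    also have "degree (A - L) \<le> max (degree A) (degree L)" by (rule degree_diff_le_max)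
    finally show ?thesis using L by linarith
  qed simp
  then have "degree (pderiv G) = 0" using deg(1) by (simp add: degree_pderiv)
  then obtain \<kappa> where \<kappa>: "pderiv G = [:\<kappa>:]" by (metis degree_eq_zeroE)
  \<comment> \<open>A nonzero slope of \<open>G\<close> means a pole at infinity.\<close>
  have \<kappa>0: "\<kappa> = 0" if "degree A \<le> card K"
  proof -
    have "degree G = 0" using dG that by simp
    then have "pderiv G = 0" by (simp add: pderiv_eq_0_iff)
    then show ?thesis using \<kappa> by simp
  qed
  have "W = smult \<kappa> (Q 0 * Q 0) + (pderiv L * Q 0 - L * pderiv (Q 0))"
    unfolding W_def A by (simp add: pderiv_add pderiv_mult \<kappa> algebra_simps)
  moreover have "degree (smult \<kappa> (Q 0 * Q 0)) \<le> card I"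
  proof (cases "\<kappa> = 0")
    case False
    then have "card I = 2 * card K" using \<kappa>0 deg(2) by force
    then show ?thesis by (auto intro: order.trans[OF degree_smult_le] order.trans[OF degree_mult_le])
  qed simp
  moreover have "degree (pderiv L * Q 0) \<le> card I"
  proof (cases "degree L = 0")
    case True
    then have "pderiv L = 0" by (simp add: pderiv_eq_0_iff)
    then show ?thesis by simp
  next
    case False
    then have "degree L - 1 + card K \<le> card I" using L deg(3) by linarith
    then show ?thesis using degree_mult_le[of "pderiv L" "Q 0"] by (simp add: degree_pderiv)
  qed
  moreover have "degree (L * pderiv (Q 0)) \<le> card I"
    using degree_mult_le[of L "pderiv (Q 0)"] L deg(3) by (simp add: degree_pderiv)
  ultimately have W: "degree W \<le> card I"
    by (simp only:) (intro degree_add_le degree_diff_le)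
  \<comment> \<open>With this choice the coefficient of degree \<open>card I\<close> cancels in
    \<open>W - smult c (P 0)\<close>.\<close>
  define c where "c = coeff W (card I)"
  have "W - smult c (P 0) = 0"
  proof (rule poly_0_if_roots[OF inj_x[OF 0]])
    show "poly (W - smult c (P 0)) (x 0 i) = 0" if "i \<in> I" for i
    proof -
      have "poly (P 0) (x 0 i) = 0" using that finite_I by (auto simp: P_def poly_linprod_eq_0_iff)
      then show ?thesis using crit[OF that] by (simp add: W_def)
    qed
    have "coeff (W - smult c (P 0)) (card I) = 0"
      using lead_coeff_linprod[of I "x 0"] by (simp add: c_def P_def)
    then show "degree (W - smult c (P 0)) < card I"
      using card_pos W by (intro degree_less_if_coeff_0 degree_diff_le order.trans[OF degree_smult_le]) auto
  qed
  then have W_eq: "W = smult c (P 0)" by simp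
  have A_B: "poly A (\<zeta> 0 k) * poly (B 0 k) (\<zeta> 0 k) = - c * poly (P 0) (\<zeta> 0 k)" if "k \<in> K" for k
    using arg_cong[OF W_eq, of "\<lambda>p. poly p (\<zeta> 0 k)"]
    by (simp add: W_def Q_\<zeta>[OF 0 that] Q'_\<zeta>[OF 0 that] minus_equation_iff)
  have "c \<noteq> 0"
    using A_B A_\<zeta> B_\<zeta>_nz[OF 0] K_ne by fastforce
  have "frac_num c 0 - L = 0"
  proof (rule poly_0_if_roots[OF inj_\<zeta>[OF 0]])
    fix k assume k: "k \<in> K"
    have "poly (num c G 0) (\<zeta> 0 k) = poly A (\<zeta> 0 k)"
      using num_\<zeta>[OF 0 k, of c G] A_B[OF k] B_\<zeta>_nz[OF 0 k] by (metis mult_right_cancel)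
    then show "poly (frac_num c 0 - L) (\<zeta> 0 k) = 0"
      by (simp add: num_def A Q_\<zeta>[OF 0 k])
  next
    have "degree (frac_num c 0 - L) \<le> card K - 1"
      using degree_frac_num[of c 0] L by (intro degree_diff_le)
    then show "degree (frac_num c 0 - L) < card K" using card_pos by linarith
  qed
  then have num: "num c G 0 = A" using A by (simp add: num_def)
  show ?thesis
    using that[OF \<open>c \<noteq> 0\<close> \<kappa> num] W_eq by (simp add: num W_def)
qed

lemma num_\<zeta>_nz:
  assumes "0 \<le> t" "ereal t < T" "k \<in> K" "c \<noteq> 0"
  shows "poly (num c G t) (\<zeta> t k) \<noteq> 0"
  using num_\<zeta>[OF assms(1-3), of c G] P_\<zeta>_nz[OF assms(1-3)] assms(4) by auto

lemma Q_root_iff: "poly (Q t) z = 0 \<longleftrightarrow> (\<exists>k\<in>K. z = \<zeta> t k)"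
  by (simp add: Q_def poly_linprod_eq_0_iff finite_K)

text \<open>The Loewner equation reads \<open>\<gamma>' = P' / (2 * P)\<close> at the moving point,
  so the derivative in \<open>num_over_Q_deriv\<close> vanishes.\<close>

lemma constant_along_flow:
  assumes t: "0 \<le> t" "ereal t < T" and G: "pderiv G = [:\<kappa>:]"
    and w0: "pderiv (num c G 0) * Q 0 - num c G 0 * pderiv (Q 0) = smult c (P 0)"
    and \<gamma>: "\<And>s. s \<in> {0..t} \<Longrightarrow>
      (\<gamma> has_vector_derivative (\<Sum>i\<in>I. (1/2) / (\<gamma> s - x s i))) (at s within {0..})"
    and avoid: "\<And>s i. s \<in> {0..t} \<Longrightarrow> i \<in> I \<Longrightarrow> \<gamma> s \<noteq> x s i"
    and nz: "\<And>s. s \<in> {0..t} \<Longrightarrow> poly (Q s) (\<gamma> s) \<noteq> 0"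
  shows "poly (num c G t) (\<gamma> t) / poly (Q t) (\<gamma> t) = poly (num c G 0) (\<gamma> 0) / poly (Q 0) (\<gamma> 0)"
proof -
  define f where "f s = poly (num c G s) (\<gamma> s) / poly (Q s) (\<gamma> s)" for s
  have f': "(f has_vector_derivative 0) (at s within {0..t})" if "s \<in> {0..t}" for s
  proof -
    have s: "0 \<le> s" "ereal s < T" using that t by (auto intro: order.strict_trans1[of _ "ereal t"])
    have "poly (pderiv (P s)) (\<gamma> s) = poly (P s) (\<gamma> s) * (\<Sum>i\<in>I. 1 / (\<gamma> s - x s i))"
      unfolding P_def using avoid[OF that] by (rule poly_pderiv_linprod[OF finite_I])
    also have "(\<Sum>i\<in>I. 1 / (\<gamma> s - x s i)) = 2 * (\<Sum>i\<in>I. (1/2) / (\<gamma> s - x s i))"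
      unfolding sum_distrib_left by (intro sum.cong) (auto simp: divide_simps)
    finally have "poly (P s) (\<gamma> s) * (\<Sum>i\<in>I. (1/2) / (\<gamma> s - x s i)) - poly (pderiv (P s)) (\<gamma> s) / 2 = 0"
      by simp
    then have "(f has_vector_derivative 0) (at s within {0..})"
      using num_over_Q_deriv[OF s G w0 \<gamma>[OF that] nz[OF that]] by (simp only: f_def[abs_def]) simp
    then show ?thesis by (rule has_vector_derivative_within_subset) auto
  qed
  obtain e where e: "\<And>s. s \<in> {0..t} \<Longrightarrow> f s = e"
    using has_vector_derivative_zero_constant[OF convex_real_interval(5) f'] by metis
  have "f t = f 0" using e[of t] e[of 0] t by simp
  then show ?thesis by (simp add: f_def)
qed

text \<open>With \<open>f' = c * P / Q^2\<close>, the terms containing \<open>P * Q'\<close> cancel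
  in \<open>- f'' / 2 - (Q' / Q) * f'\<close>, leaving \<open>- c * P' / (2 * Q^2)\<close>, the time
  derivative at a fixed point.\<close>

lemma rational_parabolic:
  assumes t: "0 \<le> t" "ereal t < T" and G: "pderiv G = [:\<kappa>:]"
    and w0: "pderiv (num c G 0) * Q 0 - num c G 0 * pderiv (Q 0) = smult c (P 0)"
    and f: "\<And>s z. poly (Q s) z \<noteq> 0 \<Longrightarrow> f s z = poly (num c G s) z / poly (Q s) z"
    and nz: "poly (Q t) z \<noteq> 0"
  shows "((\<lambda>s. f s z) has_vector_derivative
      - (1/2) * deriv (deriv (f t)) z - poly (pderiv (Q t)) z / poly (Q t) z * deriv (f t) z)
      (at t within {0..})"
proof -
  note w = wronskian[OF t G w0]
  have ft: "f t z = poly (num c G t) z / poly (Q t) z" if "poly (Q t) z \<noteq> 0" for z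
    using that by (rule f)
  \<comment> \<open>By continuity \<open>z\<close> is not a root of \<open>Q s\<close> for
    \<open>s\<close> near \<open>t\<close>, where the formula for \<open>f\<close> therefore
    applies.\<close>
  have "((\<lambda>s. poly (Q s) z) \<longlongrightarrow> poly (Q t) z) (at t within {0..})"
    using has_vector_derivative_continuous[OF has_vector_derivative_poly[OF Q_deriv[OF t]]]
    by (simp add: continuous_within)
  then have "\<forall>\<^sub>F s in at t within {0..}. poly (Q s) z \<noteq> 0"
    using nz by (rule tendsto_imp_eventually_ne)
  then have ev: "\<forall>\<^sub>F s in at t within {0..}. poly (num c G s) z / poly (Q s) z = f s z"
    by eventually_elim (simp add: f)
  have "((\<lambda>s. f s z) has_vector_derivative
      c * (poly (P t) z * 0 - poly (pderiv (P t)) z / 2) / (poly (Q t) z)\<^sup>2) (at t within {0..})"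
    by (rule has_vector_derivative_transform_eventually[OF
          num_over_Q_deriv[OF t G w0 has_vector_derivative_const nz] ev])
       (use t nz f in auto)
  also have "c * (poly (P t) z * 0 - poly (pderiv (P t)) z / 2) / (poly (Q t) z)\<^sup>2
      = - (1/2) * deriv (deriv (f t)) z - poly (pderiv (Q t)) z / poly (Q t) z * deriv (f t) z"
  proof -
    have "deriv (f t) z = c * poly (P t) z / (poly (Q t) z)\<^sup>2"
      by (rule deriv_rational[OF w _ nz]) (rule ft)
    moreover have "deriv (deriv (f t)) z
        = c * (poly (pderiv (P t)) z * poly (Q t) z - 2 * poly (P t) z * poly (pderiv (Q t)) z) / poly (Q t) z ^ 3"
      by (rule deriv2_rational[OF w _ nz]) (rule ft)
    ultimately show ?thesis
      using nz by (simp only:) (simp add: field_simps power2_eq_square power3_eq_cube)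
  qed
  finally show ?thesis .
qed

end

section \<open>Ordinary differential equations\<close>

text \<open>By an integrating factor, \<open>d s * exp (- J s)\<close> is constant.\<close>

lemma linear_ode_solution:
  fixes d a :: "real \<Rightarrow> complex"
  assumes a: "continuous_on {0..t} a"
    and d: "\<And>s. s \<in> {0..t} \<Longrightarrow> (d has_vector_derivative a s * d s) (at s within {0..t})"
    and s: "s \<in> {0..t}"
  shows "d s = d 0 * exp (integral {0..s} a)"
proof -
  define J where "J s = integral {0..s} a" for s
  have J: "(J has_vector_derivative a s) (at s within {0..t})" if "s \<in> {0..t}" for s
    unfolding J_def by (rule integral_has_vector_derivative[OF a that])
  have const: "((\<lambda>s. d s * exp (- J s)) has_vector_derivative 0) (at s within {0..t})" if s: "s \<in> {0..t}" for s
  proof -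
    have "((\<lambda>s. exp (- J s)) has_vector_derivative - a s * exp (- J s)) (at s within {0..t})"
      using field_vector_diff_chain_within[OF has_vector_derivative_minus[OF J[OF s]]
          has_field_derivative_at_within[OF DERIV_exp]] by (simp add: o_def)
    from has_vector_derivative_mult[OF d[OF s] this] show ?thesis by (simp add: algebra_simps)
  qed
  obtain e where e: "\<And>s. s \<in> {0..t} \<Longrightarrow> d s * exp (- J s) = e"
    using has_vector_derivative_zero_constant[OF convex_real_interval(5) const] by metis
  have "d s * exp (- J s) = d 0"
    using e[OF s] e[of 0] s by (simp add: J_def)
  then have "d s * (exp (- J s) * exp (J s)) = d 0 * exp (J s)" by (simp flip: mult.assoc)
  then show ?thesis by (simp add: J_def flip: exp_add)
qed

text \<open>The fixed point argument is carried out for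
  \<open>u s = exp (- 2 * L * s) * y s\<close>. With this weight the integral operator contracts by
  \<open>1/2\<close>, whatever the length of the interval.\<close>

lemma picard_lindelof:
  fixes F :: "real \<Rightarrow> 'a :: banach \<Rightarrow> 'a"
  assumes t: "0 \<le> t" and cont: "continuous_on ({0..t} \<times> UNIV) (\<lambda>(s, y). F s y)"
    and lip: "\<And>s y z. s \<in> {0..t} \<Longrightarrow> norm (F s y - F s z) \<le> L * norm (y - z)" and L: "0 < L"
  obtains y where "y 0 = y0"
    "\<And>s. s \<in> {0..t} \<Longrightarrow> (y has_vector_derivative F s (y s)) (at s within {0..t})"
proof -
  \<comment> \<open>Clamping time to \<open>{0..t}\<close> extends functions on the interval to
    bounded continuous functions on the line, a complete space.\<close>
  define c where "c s = max 0 (min t s)" for s :: real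
  have c: "c s \<in> {0..t}" for s using t by (simp add: c_def)
  have c_id: "c s = s" if "s \<in> {0..t}" for s using that by (simp add: c_def)
  define h where "h u r = F r (exp (2 * L * r) *\<^sub>R apply_bcontfun u r)" for u r
  define H where "H u s = exp (- 2 * L * s) *\<^sub>R (y0 + integral {0..s} (h u))" for u s
  have h: "continuous_on {0..t} (h u)" for u
  proof -
    have "continuous_on {0..t} (\<lambda>r. (r, exp (2 * L * r) *\<^sub>R apply_bcontfun u r))"
      by (intro continuous_intros continuous_on_apply_bcontfun)
    then have "continuous_on {0..t} (\<lambda>r. (\<lambda>(s, y). F s y) (r, exp (2 * L * r) *\<^sub>R apply_bcontfun u r))"
      by (rule continuous_on_compose2[OF cont]) auto
    then show ?thesis by (simp add: h_def)
  qed
  have int: "h u integrable_on {0..s}" if "s \<in> {0..t}" for u s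
    using that by (intro integrable_continuous_real continuous_on_subset[OF h]) auto
  have H: "continuous_on {0..t} (H u)" for u
    unfolding H_def by (intro continuous_intros indefinite_integral_continuous_1 int) (use t in auto)
  have "(\<lambda>s. H u (c s)) \<in> bcontfun" for u
    unfolding bcontfun_def
  proof (intro CollectI conjI)
    show "continuous_on UNIV (\<lambda>s. H u (c s))"
    proof (rule continuous_on_compose2[OF H])
      show "continuous_on UNIV c" unfolding c_def by (intro continuous_intros)
    qed (use c in auto)
    have "bounded (H u ` {0..t})"
      by (intro compact_imp_bounded compact_continuous_image H compact_Icc)
    then show "bounded (range (\<lambda>s. H u (c s)))"
      by (rule bounded_subset) (use c in blast)
  qed
  then have app: "apply_bcontfun (Bcontfun (\<lambda>s. H u (c s))) s = H u (c s)" for u s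
    by (simp add: Bcontfun_inverse)
  have contr: "norm (H u s - H v s) \<le> 1/2 * dist u v" if s: "s \<in> {0..t}" for u v s
  proof -
    define D where "D = dist u v"
    have D: "0 \<le> D" by (simp add: D_def)
    \<comment> \<open>The exponent \<open>2 * L\<close> is the source of the contraction factor
      \<open>1/2\<close>.\<close>
    have I: "((\<lambda>r. L * exp (2 * L * r) * D) has_integral (exp (2 * L * s) * D / 2 - exp (2 * L * 0) * D / 2)) {0..s}"
      using s L by (intro fundamental_theorem_of_calculus)
        (auto intro!: derivative_eq_intros simp flip: has_real_derivative_iff_has_vector_derivative)
    have "norm (integral {0..s} (\<lambda>r. h u r - h v r)) \<le> integral {0..s} (\<lambda>r. L * exp (2 * L * r) * D)"
    proof (rule integral_norm_bound_integral)
      show "(\<lambda>r. h u r - h v r) integrable_on {0..s}" by (intro integrable_diff int s)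
      show "(\<lambda>r. L * exp (2 * L * r) * D) integrable_on {0..s}" using I by blast
      fix r assume "r \<in> {0..s}"
      then have r: "r \<in> {0..t}" using s by auto
      have "norm (h u r - h v r)
          \<le> L * norm (exp (2 * L * r) *\<^sub>R apply_bcontfun u r - exp (2 * L * r) *\<^sub>R apply_bcontfun v r)"
        unfolding h_def by (rule lip[OF r])
      also have "\<dots> = L * exp (2 * L * r) * dist (apply_bcontfun u r) (apply_bcontfun v r)"
        by (simp add: dist_norm flip: scaleR_diff_right)
      also have "\<dots> \<le> L * exp (2 * L * r) * D"
        unfolding D_def using L by (intro mult_left_mono dist_bounded) auto
      finally show "norm (h u r - h v r) \<le> L * exp (2 * L * r) * D" .
    qed
    also have "\<dots> \<le> exp (2 * L * s) * D / 2"
      using D by (simp only: integral_unique[OF I]) simp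
    finally have "exp (- 2 * L * s) * norm (integral {0..s} (h u) - integral {0..s} (h v))
        \<le> exp (- 2 * L * s) * (exp (2 * L * s) * D / 2)"
      using int s by (intro mult_left_mono) (auto simp: integral_diff)
    also have "\<dots> = 1/2 * D" by (simp add: exp_minus field_simps)
    finally show ?thesis
      by (simp add: H_def D_def flip: scaleR_diff_right)
  qed
  have "\<exists>!u. Bcontfun (\<lambda>s. H u (c s)) = u"
  proof (rule banach_fix_type[of "1/2"], goal_cases)
    case 3
    show ?case
      by (intro allI dist_bound) (simp only: app dist_norm[of "H _ _"] contr[OF c])
  qed simp_all
  then obtain u where u: "Bcontfun (\<lambda>s. H u (c s)) = u" by blast
  define y where "y s = y0 + integral {0..s} (h u)" for s
  have hu: "h u s = F s (y s)" if "s \<in> {0..t}" for s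
  proof -
    have "apply_bcontfun u s = H u s" using app[of u s] c_id[OF that] by (simp add: u)
    then show ?thesis by (simp add: h_def H_def y_def flip: exp_add)
  qed
  show ?thesis
  proof (rule that)
    show "y 0 = y0" by (simp add: y_def)
    fix s assume s: "s \<in> {0..t}"
    have "(y has_vector_derivative 0 + h u s) (at s within {0..t})"
      unfolding y_def by (intro has_vector_derivative_add has_vector_derivative_const
          integral_has_vector_derivative h s)
    then show "(y has_vector_derivative F s (y s)) (at s within {0..t})"
      using hu[OF s] by simp
  qed
qed

section \<open>The Loewner flow\<close>

lemma half_inverse_diff: "u \<noteq> 0 \<Longrightarrow> v \<noteq> 0 \<Longrightarrow> (1/2) / u - (1/2) / v = (v - u) / (2 * (u * v))"
  for u v :: "'a :: field_char_0"
  by (simp add: diff_divide_distrib)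

text \<open>The difference of two solutions satisfies a linear equation with continuous coefficient,
  so it is its initial value times an exponential: trajectories that meet once coincide.\<close>

lemma loewner_difference:
  fixes x :: "real \<Rightarrow> 'j \<Rightarrow> complex"
  assumes J: "finite J" "\<And>j. j \<in> J \<Longrightarrow> continuous_on {0..t} (\<lambda>s. x s j)"
    and y: "\<And>s. s \<in> {0..t} \<Longrightarrow> (y has_vector_derivative (\<Sum>j\<in>J. (1/2) / (y s - x s j))) (at s within {0..t})"
    and z: "\<And>s. s \<in> {0..t} \<Longrightarrow> (z has_vector_derivative (\<Sum>j\<in>J. (1/2) / (z s - x s j))) (at s within {0..t})"
    and nz: "\<And>s j. s \<in> {0..t} \<Longrightarrow> j \<in> J \<Longrightarrow> y s \<noteq> x s j \<and> z s \<noteq> x s j"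
    and s: "s \<in> {0..t}"
  shows "y s = z s \<longleftrightarrow> y 0 = z 0"
proof -
  define a where "a s = (\<Sum>j\<in>J. - 1 / (2 * ((y s - x s j) * (z s - x s j))))" for s
  have "continuous_on {0..t} y" "continuous_on {0..t} z"
    by (rule continuous_on_vector_derivative, erule y z)+
  then have a: "continuous_on {0..t} a"
    unfolding a_def using J nz by (intro continuous_intros) auto
  have d: "((\<lambda>s. y s - z s) has_vector_derivative a s * (y s - z s)) (at s within {0..t})" if s: "s \<in> {0..t}" for s
  proof -
    have "(\<Sum>j\<in>J. (1/2) / (y s - x s j)) - (\<Sum>j\<in>J. (1/2) / (z s - x s j)) = a s * (y s - z s)"
      unfolding a_def sum_distrib_right sum_subtractf[symmetric]
    proof (intro sum.cong refl)
      fix j assume "j \<in> J"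
      then have "y s - x s j \<noteq> 0" "z s - x s j \<noteq> 0" using nz[OF s] by auto
      have *: "(b - a) / D = - 1 / D * (a - b)" for a b D :: complex
        by (simp add: diff_divide_distrib)
      show "(1/2) / (y s - x s j) - (1/2) / (z s - x s j) = - 1 / (2 * ((y s - x s j) * (z s - x s j))) * (y s - z s)"
        unfolding half_inverse_diff[OF \<open>y s - x s j \<noteq> 0\<close> \<open>z s - x s j \<noteq> 0\<close>] *[symmetric] by simp
    qed
    then show ?thesis using has_vector_derivative_diff[OF y[OF s] z[OF s]] by simp
  qed
  have "y s - z s = (y 0 - z 0) * exp (integral {0..s} a)"
    by (rule linear_ode_solution[OF a d s])
  then show ?thesis by (metis exp_not_eq_zero mult_eq_0_iff right_minus_eq)
qed

text \<open>The field driving the reversed flow is truncated below height \<open>\<epsilon>\<close> to make it globally Lipschitz.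
  Since the imaginary part increases along the reversed flow, the truncation is never felt.\<close>

definition truncate_Im :: "real \<Rightarrow> complex \<Rightarrow> complex" where
  "truncate_Im \<epsilon> z = Complex (Re z) (max (Im z) \<epsilon>)"

lemma Im_truncate_Im: "Im (truncate_Im \<epsilon> z) \<ge> \<epsilon>"
  by (simp add: truncate_Im_def)

lemma truncate_Im_id: "\<epsilon> \<le> Im z \<Longrightarrow> truncate_Im \<epsilon> z = z"
  by (simp add: truncate_Im_def complex_eq_iff)

lemma truncate_Im_nonexpansive: "cmod (truncate_Im \<epsilon> y - truncate_Im \<epsilon> z) \<le> cmod (y - z)"
proof -
  have "\<bar>max (Im y) \<epsilon> - max (Im z) \<epsilon>\<bar> \<le> \<bar>Im y - Im z\<bar>" by linarith
  then have "(max (Im y) \<epsilon> - max (Im z) \<epsilon>)\<^sup>2 \<le> (Im y - Im z)\<^sup>2" by (simp add: abs_le_square_iff)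
  then show ?thesis by (simp add: cmod_def truncate_Im_def)
qed

lemma continuous_on_truncate_Im: "continuous_on S (truncate_Im \<epsilon>)"
  unfolding truncate_Im_def[abs_def] Complex_eq
  by (intro continuous_intros)

text \<open>Solve the truncated equation in reversed time from \<open>w\<close>, then reverse time
  again. The height never drops below \<open>Im w\<close>.\<close>

lemma reverse_loewner_flow:
  fixes X :: "real \<Rightarrow> 'j \<Rightarrow> real"
  assumes J: "finite J" "\<And>j. j \<in> J \<Longrightarrow> continuous_on {0..t} (\<lambda>s. X s j)"
    and t: "0 \<le> t" and w: "0 < Im w"
  shows "\<exists>y. y t = w \<and> (\<forall>s\<in>{0..t}. Im w \<le> Im (y s) \<and>
       (y has_vector_derivative (\<Sum>j\<in>J. (1/2) / (y s - of_real (X s j)))) (at s within {0..t}))"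
proof -
  define \<epsilon> where "\<epsilon> = Im w"
  define \<pi> where "\<pi> = truncate_Im \<epsilon>"
  define F where "F s h = - (\<Sum>j\<in>J. (1/2) / (\<pi> h - of_real (X (t - s) j)))" for s h
  have \<epsilon>: "0 < \<epsilon>" using w by (simp add: \<epsilon>_def)
  have \<pi>: "\<epsilon> \<le> cmod (\<pi> h - of_real a)" for h a
    using abs_Im_le_cmod[of "\<pi> h - of_real a"] Im_truncate_Im[of \<epsilon> h] by (simp add: \<pi>_def)
  then have \<pi>_nz: "\<pi> h - of_real a \<noteq> 0" for h a using \<epsilon> by (metis norm_zero not_less)
  \<comment> \<open>Each summand has Lipschitz constant \<open>1 / (2 * \<epsilon>^2)\<close>, as
    the truncation is nonexpansive and keeps distance \<open>\<epsilon>\<close> from the real line.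
    The added 1 makes \<open>L\<close> positive even when \<open>J\<close> is empty.\<close>
  define L where "L = real (card J) / (2 * \<epsilon>\<^sup>2) + 1"
  have L: "0 < L" unfolding L_def by (intro add_nonneg_pos) auto
  have lip: "norm (F s h - F s k) \<le> L * norm (h - k)" for s h k
  proof -
    have "norm (F s k - F s h) \<le> (\<Sum>j\<in>J. norm (h - k) / (2 * \<epsilon>\<^sup>2))"
      unfolding F_def minus_diff_minus sum_subtractf[symmetric] norm_minus_cancel
    proof (rule sum_norm_le)
      fix j
      let ?a = "of_real (X (t - s) j) :: complex"
      have "(1/2) / (\<pi> h - ?a) - (1/2) / (\<pi> k - ?a) = (\<pi> k - \<pi> h) / (2 * ((\<pi> h - ?a) * (\<pi> k - ?a)))"
        by (rule trans[OF half_inverse_diff[OF \<pi>_nz \<pi>_nz]]) simp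
      note e = this
      have "norm ((1/2) / (\<pi> k - ?a) - (1/2) / (\<pi> h - ?a))
          = cmod (\<pi> k - \<pi> h) / (2 * (cmod (\<pi> h - ?a) * cmod (\<pi> k - ?a)))"
        by (subst norm_minus_commute) (simp only: e norm_divide norm_mult norm_numeral)
      also have "\<dots> \<le> cmod (h - k) / (2 * \<epsilon>\<^sup>2)"
        using truncate_Im_nonexpansive[of \<epsilon> k h] \<epsilon> \<pi> unfolding power2_eq_square \<pi>_def
        by (intro frac_le mult_left_mono mult_mono) (auto simp: norm_minus_commute[of k h])
      finally show "norm ((1/2) / (\<pi> k - ?a) - (1/2) / (\<pi> h - ?a)) \<le> norm (h - k) / (2 * \<epsilon>\<^sup>2)" .
    qed
    also have "\<dots> \<le> L * norm (h - k)"
      by (simp add: L_def distrib_right)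
    finally show ?thesis by (simp add: norm_minus_commute)
  qed
  have cont: "continuous_on ({0..t} \<times> UNIV) (\<lambda>(s, h). F s h)"
  proof -
    have "continuous_on ({0..t} \<times> UNIV) (\<lambda>p. X (t - fst p) j)" if "j \<in> J" for j
      by (rule continuous_on_compose2[OF J(2)[OF that], where f = "\<lambda>p. t - fst p"])
         (auto intro!: continuous_intros)
    moreover have "continuous_on ({0..t} \<times> UNIV) (\<lambda>p :: real \<times> complex. \<pi> (snd p))"
      unfolding \<pi>_def
      by (rule continuous_on_compose2[OF continuous_on_truncate_Im[of UNIV]]) (auto intro!: continuous_intros)
    ultimately show ?thesis
      unfolding F_def case_prod_unfold using \<pi>_nz by (intro continuous_intros) auto
  qed
  obtain h where h0: "h 0 = w"
    and h: "\<And>s. s \<in> {0..t} \<Longrightarrow> (h has_vector_derivative F s (h s)) (at s within {0..t})"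
    by (rule picard_lindelof[OF t cont lip L]) (rule that)
  have Im_F: "0 \<le> Im (F s k)" for s k
  proof -
    have "Im ((1/2) / (\<pi> k - of_real a)) \<le> 0" for a
      using Im_truncate_Im[of \<epsilon> k] \<epsilon> by (simp add: Im_divide \<pi>_def divide_nonneg_nonneg)
    then show ?thesis by (simp add: F_def sum_nonpos)
  qed
  have Im_h: "\<epsilon> \<le> Im (h s)" if s: "s \<in> {0..t}" for s
  proof -
    have "((\<lambda>s. Im (h s)) has_vector_derivative Im (F r (h r))) (at r within {0..s})" if "r \<in> {0..s}" for r
      by (rule bounded_linear.has_vector_derivative[OF bounded_linear_Im
            has_vector_derivative_within_subset[OF h]]) (use s that in auto)
    then have "((\<lambda>r. Im (F r (h r))) has_integral Im (h s) - Im (h 0)) {0..s}"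
      using s by (intro fundamental_theorem_of_calculus) auto
    then have "0 \<le> Im (h s) - Im (h 0)"
      by (rule has_integral_nonneg) (rule Im_F)
    then show ?thesis by (simp add: h0 \<epsilon>_def)
  qed
  show ?thesis
  proof (intro exI[of _ "\<lambda>s. h (t - s)"] conjI ballI)
    show "h (t - t) = w" by (simp add: h0)
    show "Im w \<le> Im (h (t - s))" if "s \<in> {0..t}" for s
      using Im_h[of "t - s"] that by (simp add: \<epsilon>_def)
    fix s assume s: "s \<in> {0..t}"
    then have ts: "t - s \<in> {0..t}" by auto
    have im: "(\<lambda>r. t - r) ` {0..t} \<subseteq> {0..t}" by auto
    have "((\<lambda>r. t - r) has_vector_derivative -1) (at s within {0..t})"
      by (auto intro!: derivative_eq_intros)
    moreover have "(h has_vector_derivative F (t - s) (h (t - s))) (at (t - s) within (\<lambda>r. t - r) ` {0..t})"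
      by (rule has_vector_derivative_within_subset[OF h[OF ts] im])
    ultimately have "(h \<circ> (\<lambda>r. t - r) has_vector_derivative (-1) *\<^sub>R F (t - s) (h (t - s))) (at s within {0..t})"
      by (rule vector_diff_chain_within)
    moreover have "\<pi> (h (t - s)) = h (t - s)"
      unfolding \<pi>_def by (rule truncate_Im_id[OF Im_h[OF ts]])
    ultimately show "((\<lambda>s. h (t - s)) has_vector_derivative
        (\<Sum>j\<in>J. (1/2) / (h (t - s) - of_real (X s j)))) (at s within {0..t})"
      by (simp add: F_def o_def)
  qed
qed

section \<open>Loewner chains and their surjectivity onto the upper half-plane\<close>

lemma
  assumes "loewner_chain N X T \<sigma> g"
  shows loewner_chain_lifetime_pos: "(\<And>j. j \<in> {1..N} \<Longrightarrow> z \<noteq> of_real (X 0 j)) \<Longrightarrow> 0 < \<sigma> z"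
    and loewner_chain_initial: "0 < \<sigma> z \<Longrightarrow> g 0 z = z"
    and loewner_chain_avoids:
      "\<lbrakk>0 \<le> t; ereal t < \<sigma> z; j \<in> {1..N}\<rbrakk> \<Longrightarrow> g t z \<noteq> of_real (X t j)"
    and loewner_chain_deriv: "\<lbrakk>0 \<le> t; ereal t < \<sigma> z\<rbrakk> \<Longrightarrow> ((\<lambda>s. g s z) has_vector_derivative
      (\<Sum>j\<in>{1..N}. (1/2) / (g t z - of_real (X t j)))) (at t within {0..})"
    and loewner_chain_lifetime_end: "\<lbrakk>0 < \<sigma> z; \<sigma> z < T; 0 < \<epsilon>\<rbrakk> \<Longrightarrow>
      \<exists>t\<ge>0. ereal t < \<sigma> z \<and> (\<exists>j\<in>{1..N}. cmod (g t z - of_real (X t j)) < \<epsilon>)"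
proof -
  note c = assms[unfolded loewner_chain_def]
  have "0 \<le> \<sigma> z" "\<sigma> z = 0 \<longleftrightarrow> (\<exists>j\<in>{1..N}. z = of_real (X 0 j))" using c by (simp_all only:)
  then show "(\<And>j. j \<in> {1..N} \<Longrightarrow> z \<noteq> of_real (X 0 j)) \<Longrightarrow> 0 < \<sigma> z"
    by (auto simp: order_less_le)
  show "0 < \<sigma> z \<Longrightarrow> g 0 z = z" using c by (simp only:)
  note alive = c[THEN conjunct2, THEN conjunct2, THEN conjunct2, THEN conjunct1, THEN spec, THEN spec,
      THEN mp, OF conjI]
  show "\<lbrakk>0 \<le> t; ereal t < \<sigma> z; j \<in> {1..N}\<rbrakk> \<Longrightarrow> g t z \<noteq> of_real (X t j)"
    by (rule bspec[OF conjunct1[OF alive]])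
  show "\<lbrakk>0 \<le> t; ereal t < \<sigma> z\<rbrakk> \<Longrightarrow> ((\<lambda>s. g s z) has_vector_derivative
      (\<Sum>j\<in>{1..N}. (1/2) / (g t z - of_real (X t j)))) (at t within {0..})"
    by (rule conjunct2[OF alive])
  show "\<lbrakk>0 < \<sigma> z; \<sigma> z < T; 0 < \<epsilon>\<rbrakk> \<Longrightarrow>
      \<exists>t\<ge>0. ereal t < \<sigma> z \<and> (\<exists>j\<in>{1..N}. cmod (g t z - of_real (X t j)) < \<epsilon>)"
    using c by (simp only:)
qed

text \<open>The preimage is the end point \<open>y 0\<close> of the reversed flow. While the
  trajectory from there is alive it agrees with \<open>y\<close>, hence stays at height at least
  \<open>Im w\<close> above the driving points and is not swallowed up to time
  \<open>t\<close>.\<close>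

lemma loewner_surj:
  assumes chain: "loewner_chain N X T \<sigma> g"
    and X: "\<And>j. j \<in> {1..N} \<Longrightarrow> continuous_on {0..t} (\<lambda>s. X s j)"
    and t: "0 \<le> t" "ereal t < T" and w: "0 < Im w"
  obtains z where "z \<in> upper_domain \<sigma> t" "g t z = w"
proof -
  have "\<exists>y. y t = w \<and> (\<forall>s\<in>{0..t}. Im w \<le> Im (y s) \<and>
       (y has_vector_derivative (\<Sum>j\<in>{1..N}. (1/2) / (y s - of_real (X s j)))) (at s within {0..t}))"
    by (rule reverse_loewner_flow[OF finite_atLeastAtMost X t(1) w])
  then obtain y where yt: "y t = w" and y_all: "\<forall>s\<in>{0..t}. Im w \<le> Im (y s) \<and>
       (y has_vector_derivative (\<Sum>j\<in>{1..N}. (1/2) / (y s - of_real (X s j)))) (at s within {0..t})"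
    by (elim exE conjE)
  have y: "y t = w" "\<And>s. s \<in> {0..t} \<Longrightarrow> Im w \<le> Im (y s)"
    "\<And>s. s \<in> {0..t} \<Longrightarrow> (y has_vector_derivative (\<Sum>j\<in>{1..N}. (1/2) / (y s - of_real (X s j)))) (at s within {0..t})"
    using yt y_all by (simp_all only:)
  define z where "z = y 0"
  have Im_z: "0 < Im z" using y(2)[of 0] t w by (simp add: z_def)
  then have "z \<noteq> of_real a" for a by auto
  then have \<sigma>_pos: "0 < \<sigma> z" by (rule loewner_chain_lifetime_pos[OF chain])
  have "g s z = y s" if s: "0 \<le> s" "s \<le> t" "ereal s < \<sigma> z" for s
  proof -
    have "g s z = y s \<longleftrightarrow> g 0 z = y 0"
    proof (rule loewner_difference[where J = "{1..N}" and t = s and x = "\<lambda>s j. complex_of_real (X s j)"])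
      fix r assume r: "r \<in> {0..s}"
      then have r': "ereal r < \<sigma> z" using s(3) by (auto intro: order.strict_trans1[of _ "ereal s"])
      show "((\<lambda>s. g s z) has_vector_derivative (\<Sum>j\<in>{1..N}. (1/2) / (g r z - of_real (X r j)))) (at r within {0..s})"
        by (rule has_vector_derivative_within_subset[OF loewner_chain_deriv[OF chain _ r']]) (use r in auto)
      show "(y has_vector_derivative (\<Sum>j\<in>{1..N}. (1/2) / (y r - of_real (X r j)))) (at r within {0..s})"
        using r s by (intro has_vector_derivative_within_subset[OF y(3)]) auto
      show "g r z \<noteq> of_real (X r j) \<and> y r \<noteq> of_real (X r j)" if "j \<in> {1..N}" for j
      proof
        show "g r z \<noteq> of_real (X r j)"
          using loewner_chain_avoids[OF chain _ r' that] r by auto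
        have "0 < Im (y r)" using y(2)[of r] r s w by auto
        then show "y r \<noteq> of_real (X r j)" by auto
      qed
    next
      show "continuous_on {0..s} (\<lambda>s. complex_of_real (X s j))" if "j \<in> {1..N}" for j
        using s by (intro continuous_on_of_real continuous_on_subset[OF X[OF that]]) auto
    qed (use s in auto)
    then show ?thesis using loewner_chain_initial[OF chain \<sigma>_pos] by (simp add: z_def)
  qed
  note g_eq = this
  have "ereal t < \<sigma> z"
  proof (rule ccontr)
    assume "\<not> ereal t < \<sigma> z"
    then have le: "\<sigma> z \<le> ereal t" by simp
    then have "\<sigma> z < T" using t(2) by simp
    then obtain s j where s: "0 \<le> s" "ereal s < \<sigma> z" and close: "cmod (g s z - of_real (X s j)) < Im w"
      using loewner_chain_lifetime_end[OF chain \<sigma>_pos _ w] by blast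
    then have "ereal s \<le> ereal t" using le by order
    then have "s \<le> t" by simp
    then have "Im w \<le> Im (g s z - of_real (X s j))" using y(2)[of s] s g_eq[of s] by simp
    also have "\<dots> \<le> cmod (g s z - of_real (X s j))" by (metis abs_Im_le_cmod abs_ge_self order.trans)
    finally show False using close by simp
  qed
  then show ?thesis
    using g_eq[of t] t Im_z y(1) by (intro that[of z]) (auto simp: upper_domain_def)
qed

section \<open>The quarter superposition\<close>

lemma sum_finite_marked:
  "(\<Sum>k\<in>{1..n+1}. sphere_frac c (Some z) (marked g \<zeta> t k))
    = (\<Sum>k\<in>{k\<in>{1..n+1}. \<zeta> k \<noteq> None}. c / (z - g t (the (\<zeta> k))))"
proof -
  have "sphere_frac c (Some z) (marked g \<zeta> t k) = (if \<zeta> k \<noteq> None then c / (z - g t (the (\<zeta> k))) else 0)" for k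
    by (cases "\<zeta> k") (simp_all add: marked_def)
  then show ?thesis by (simp only: sum.inter_filter[OF finite_atLeastAtMost])
qed

text \<open>By injectivity at most one marked point lies at infinity.\<close>

lemma card_finite_points:
  assumes "inj_on \<zeta> {1..n+1}"
  shows "n \<le> card {k\<in>{1..n+1}. \<zeta> k \<noteq> None}"
    and "None \<notin> \<zeta> ` {1..n+1} \<Longrightarrow> card {k\<in>{1..n+1}. \<zeta> k \<noteq> None} = n + 1"
    and "None \<in> \<zeta> ` {1..n+1} \<Longrightarrow> card {k\<in>{1..n+1}. \<zeta> k \<noteq> None} = n"
proof -
  have eq: "{k\<in>{1..n+1}. \<zeta> k \<noteq> None} = {1..n+1} - {k\<in>{1..n+1}. \<zeta> k = None}" by auto
  show 1: "None \<notin> \<zeta> ` {1..n+1} \<Longrightarrow> card {k\<in>{1..n+1}. \<zeta> k \<noteq> None} = n + 1"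
  proof -
    assume "None \<notin> \<zeta> ` {1..n+1}"
    then have "{k\<in>{1..n+1}. \<zeta> k \<noteq> None} = {1..n+1}" by force
    then show ?thesis by simp
  qed
  show 2: "None \<in> \<zeta> ` {1..n+1} \<Longrightarrow> card {k\<in>{1..n+1}. \<zeta> k \<noteq> None} = n"
  proof -
    assume "None \<in> \<zeta> ` {1..n+1}"
    then obtain k where k: "k \<in> {1..n+1}" "\<zeta> k = None" by auto
    then have "{k\<in>{1..n+1}. \<zeta> k \<noteq> None} = {1..n+1} - {k}"
    proof -
      have "l = k" if "l \<in> {1..n+1}" "\<zeta> l = None" for l
        using inj_onD[OF assms, of l k] that k by simp
      then show ?thesis using k(2) by blast
    qed
    then show ?thesis using k by simp
  qed
  show "n \<le> card {k\<in>{1..n+1}. \<zeta> k \<noteq> None}" using 1 2 by linarith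
qed

text \<open>A marked point at infinity contributes 0 to the drift and to the stationary relation, so
  both can be restricted to the finite ones.\<close>

lemma superposition_flow:
  assumes n: "n \<ge> 1" and zeta: "inj_on \<zeta> {1..n+1}" and stat: "stationary n x \<zeta>" and T: "0 < T"
    and chain: "quarter_superposition n x \<zeta> T X \<sigma> g" and nc: "no_collision n \<zeta> T X \<sigma> g"
  shows "stationary_flow {1..2*n} {k\<in>{1..n+1}. \<zeta> k \<noteq> None}
    (\<lambda>t j. complex_of_real (X t j)) (\<lambda>t k. g t (the (\<zeta> k))) T"
    (is "stationary_flow ?I ?K ?x ?\<zeta> T")
proof -
  have lc: "loewner_chain (2*n) X T \<sigma> g" and X0: "\<And>j. j \<in> {1..2*n} \<Longrightarrow> X 0 j = x j"
    and drift: "\<And>j t. \<lbrakk>j \<in> {1..2*n}; 0 \<le> t; ereal t < T\<rbrakk> \<Longrightarrow>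
      ((\<lambda>s. complex_of_real (X s j)) has_vector_derivative
           superposition_drift n (X t) (marked g \<zeta> t) j) (at t within {0..})"
    using chain unfolding quarter_superposition_def by auto
  have alive: "T \<le> \<sigma> (the (\<zeta> k))" if "k \<in> ?K" for k
    using nc that unfolding no_collision_def by auto
  have inj_X: "inj_on (X t) {1..2*n}" and inj_m: "inj_on (marked g \<zeta> t) {1..n+1}"
    and disj: "\<And>j k. j \<in> {1..2*n} \<Longrightarrow> k \<in> {1..n+1} \<Longrightarrow> marked g \<zeta> t k \<noteq> Some (of_real (X t j))"
    if "0 \<le> t" "ereal t < T" for t
    using nc that unfolding no_collision_def by auto
  have marked: "marked g \<zeta> t k = Some (?\<zeta> t k)" if "k \<in> ?K" for t k
    using that by (auto simp: marked_def)
  \<comment> \<open>This gives a finite marked point, as \<open>n\<close> is positive, and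
    \<open>card ?I \<le> 2 * card ?K\<close>.\<close>
  have n_le: "n \<le> card ?K" by (rule card_finite_points(1)[OF zeta])
  interpret particle_flow ?I ?K ?x ?\<zeta> T
  proof
    show "finite ?I" "finite ?K" "?I \<noteq> {}" using n by auto
    have "0 < card ?K" using n n_le by linarith
    then show "?K \<noteq> {}" unfolding card_gt_0_iff by (rule conjunct1)
    fix t assume t: "0 \<le> t" "ereal t < T"
    show "inj_on (?x t) ?I"
    proof (rule inj_onI)
      fix i j assume ij: "i \<in> ?I" "j \<in> ?I" "?x t i = ?x t j"
      then have "X t i = X t j" by (simp only: of_real_eq_iff)
      then show "i = j" by (rule inj_onD[OF inj_X[OF t]]) (rule ij)+
    qed
    show "inj_on (?\<zeta> t) ?K"
    proof (rule inj_onI)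
      fix k l assume kl: "k \<in> ?K" "l \<in> ?K" "?\<zeta> t k = ?\<zeta> t l"
      have "marked g \<zeta> t k = marked g \<zeta> t l"
        unfolding marked[OF kl(1)] marked[OF kl(2)] kl(3) by (rule refl)
      then show "k = l" by (rule inj_onD[OF inj_m[OF t]]) (use kl(1,2) in auto)
    qed
    show "?x t i \<noteq> ?\<zeta> t k" if "i \<in> ?I" "k \<in> ?K" for i k
      using disj[OF t that(1), of k] that(2) marked[OF that(2), of t] by auto
    show "((\<lambda>s. ?x s i) has_vector_derivative
        (\<Sum>j\<in>?I - {i}. 1 / (?x t i - ?x t j)) - (\<Sum>k\<in>?K. 1 / (?x t i - ?\<zeta> t k))) (at t within {0..})"
      if "i \<in> ?I" for i
    proof -
      have "superposition_drift n (X t) (marked g \<zeta> t) i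
        = (\<Sum>j\<in>?I - {i}. (1/4) * (2 / (?x t i - ?x t j)) + (1/2) / (?x t i - ?x t j))
          - (\<Sum>k\<in>?K. (1/4) * (4 / (?x t i - ?\<zeta> t k)))"
        unfolding superposition_drift_def sum_finite_marked sum.distrib right_diff_distrib sum_distrib_left
        by simp
      also have "\<dots> = (\<Sum>j\<in>?I - {i}. 1 / (?x t i - ?x t j)) - (\<Sum>k\<in>?K. 1 / (?x t i - ?\<zeta> t k))"
      proof -
        have "(1/4) * (2 / u) + (1/2) / u = 1 / u" "(1/4) * (4 / u) = 1 / u" for u :: complex
          by (auto simp: divide_simps)
        then show ?thesis by (simp only:)
      qed
      finally show ?thesis using drift[OF that t] by simp
    qed
    show "((\<lambda>s. ?\<zeta> s k) has_vector_derivative (\<Sum>i\<in>?I. (1/2) / (?\<zeta> t k - ?x t i))) (at t within {0..})"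
      if "k \<in> ?K" for k
      using loewner_chain_deriv[OF lc t(1)] alive[OF that] t(2) by (meson less_le_trans)
  qed
  show ?thesis
  proof
    show "0 < T" by (rule T)
    show "card ?I \<le> 2 * card ?K" using n_le by simp
    fix k assume k: "k \<in> ?K"
    have 0: "0 \<le> (0::real)" "ereal 0 < T" using T by (simp_all flip: zero_ereal_def)
    have g0: "?\<zeta> 0 k = the (\<zeta> k)" if "k \<in> ?K" for k
      by (rule loewner_chain_initial[OF lc]) (rule less_le_trans[OF T alive[OF that]])
    have Some_\<zeta>: "\<zeta> l = Some (?\<zeta> 0 l)" if "l \<in> ?K" for l
      unfolding g0[OF that] using that by simp
    have "k \<in> {1..n+1}" using k by simp
    with stat have "(\<Sum>j\<in>?I. sphere_frac 1 (\<zeta> k) (Some (of_real (x j))))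
        = (\<Sum>l\<in>{1..n+1} - {k}. sphere_frac 2 (\<zeta> k) (\<zeta> l))"
      unfolding stationary_def by blast
    also have "(\<Sum>j\<in>?I. sphere_frac 1 (\<zeta> k) (Some (of_real (x j)))) = (\<Sum>i\<in>?I. 1 / (?\<zeta> 0 k - ?x 0 i))"
    proof (intro sum.cong refl)
      fix i assume "i \<in> ?I"
      then have x: "x i = X 0 i" by (simp only: X0)
      have "sphere_frac 1 (\<zeta> k) (Some (of_real (x i))) = sphere_frac 1 (Some (?\<zeta> 0 k)) (Some (?x 0 i))"
        unfolding x by (rule arg_cong2[OF Some_\<zeta>[OF k] refl])
      then show "sphere_frac 1 (\<zeta> k) (Some (of_real (x i))) = 1 / (?\<zeta> 0 k - ?x 0 i)"
        by (simp only: sphere_frac.simps)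
    qed
    also have "(\<Sum>l\<in>{1..n+1} - {k}. sphere_frac 2 (\<zeta> k) (\<zeta> l)) = (\<Sum>l\<in>?K - {k}. 2 / (?\<zeta> 0 k - ?\<zeta> 0 l))"
    proof (rule sum.mono_neutral_cong_right)
      fix l assume l: "l \<in> ?K - {k}"
      have "sphere_frac 2 (\<zeta> k) (\<zeta> l) = sphere_frac 2 (Some (?\<zeta> 0 k)) (Some (?\<zeta> 0 l))"
        by (rule arg_cong2[OF Some_\<zeta>[OF k] Some_\<zeta>]) (use l in simp)
      then show "sphere_frac 2 (\<zeta> k) (\<zeta> l) = 2 / (?\<zeta> 0 k - ?\<zeta> 0 l)"
        by (simp only: sphere_frac.simps)
    next
      have "sphere_frac 2 a None = 0" for a by (cases a) simp_all
      moreover have "\<zeta> l = None" if "l \<in> ({1..n+1} - {k}) - (?K - {k})" for l using that by blast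
      ultimately show "\<forall>l\<in>({1..n+1} - {k}) - (?K - {k}). sphere_frac 2 (\<zeta> k) (\<zeta> l) = 0"
        by (intro ballI) (simp only:)
    qed auto
    also have "(\<Sum>l\<in>?K - {k}. 2 / (?\<zeta> 0 k - ?\<zeta> 0 l)) = 2 * (\<Sum>l\<in>?K - {k}. 1 / (?\<zeta> 0 k - ?\<zeta> 0 l))"
      by (simp add: sum_distrib_left)
    finally have stat_k: "(\<Sum>i\<in>?I. 1 / (?\<zeta> 0 k - ?x 0 i)) = 2 * (\<Sum>l\<in>?K - {k}. 1 / (?\<zeta> 0 k - ?\<zeta> 0 l))" .
    \<comment> \<open>Both sums in \<open>stat_k\<close> are logarithmic derivatives, of
      \<open>P\<close> and of \<open>B\<close>.\<close>
    have "poly (pderiv (P 0)) (?\<zeta> 0 k) = poly (P 0) (?\<zeta> 0 k) * (\<Sum>i\<in>?I. 1 / (?\<zeta> 0 k - ?x 0 i))"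
      unfolding P_def
    proof (rule poly_pderiv_linprod[OF finite_I])
      show "?\<zeta> 0 k \<noteq> ?x 0 i" if "i \<in> ?I" for i using disjoint[OF 0 that k] by (rule not_sym)
    qed
    moreover have "poly (pderiv (B 0 k)) (?\<zeta> 0 k)
        = poly (B 0 k) (?\<zeta> 0 k) * (\<Sum>l\<in>?K - {k}. 1 / (?\<zeta> 0 k - ?\<zeta> 0 l))"
      unfolding B_def
    proof (rule poly_pderiv_linprod)
      show "?\<zeta> 0 k \<noteq> ?\<zeta> 0 l" if "l \<in> ?K - {k}" for l
        using inj_onD[OF inj_\<zeta>[OF 0], of k l] that k by auto
    qed (use finite_K in simp)
    ultimately show "poly (pderiv (P 0)) (?\<zeta> 0 k) * poly (B 0 k) (?\<zeta> 0 k)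
        = 2 * poly (P 0) (?\<zeta> 0 k) * poly (pderiv (B 0 k)) (?\<zeta> 0 k)"
      unfolding stat_k by (simp add: mult_ac)
  qed
qed

section \<open>Critical points and poles read off the reduced fraction\<close>

lemma sphere_critical_finite:
  assumes crit: "sphere_critical (rat_map R) (Some z)" and nz: "poly (rat_den R) z \<noteq> 0"
  shows "poly (pderiv (rat_num R) * rat_den R - rat_num R * pderiv (rat_den R)) z = 0"
proof -
  have "\<forall>\<^sub>F w in nhds z. poly (rat_den R) w \<noteq> 0"
    using nz eventually_nhds_in_open[of "{u. poly (rat_den R) u \<noteq> 0}" z]
    by (simp add: open_Collect_neq continuous_on_poly)
  \<comment> \<open>Near a point that is not a pole the target chart is the identity, so the
    derivative is the ordinary one.\<close>
  then have "\<forall>\<^sub>F w in nhds z. target_chart (rat_map R) (Some z) (Some w) = poly (rat_num R) w / poly (rat_den R) w"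
    by eventually_elim (simp add: target_chart_def nz rat_eval_def)
  then have "deriv (\<lambda>w. target_chart (rat_map R) (Some z) (Some w)) z
      = deriv (\<lambda>w. poly (rat_num R) w / poly (rat_den R) w) z"
    by (rule deriv_cong_ev) simp
  also have "\<dots> = (poly (pderiv (rat_num R)) z * poly (rat_den R) z - poly (rat_num R) z * poly (pderiv (rat_den R)) z)
      / (poly (rat_den R) z * poly (rat_den R) z)"
    using nz by (intro DERIV_imp_deriv DERIV_divide poly_DERIV)
  finally show ?thesis using crit nz by simp
qed

lemma rat_den_nonzero: "rat_den R \<noteq> 0"
  by (simp add: rat_den_def)

lemma rat_den_monic: "lead_coeff (rat_den R) = 1"
  using unit_factor_snd_quot_of_fract[of R] rat_den_nonzero[of R]
  by (simp add: rat_den_def unit_factor_poly_def unit_factor_field_def one_pCons split: if_splits)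

text \<open>The finite poles divide the denominator, and the degree leaves no room for more: without
  a pole at infinity there are \<open>n + 1\<close> of them; with one, the denominator has smaller
  degree than the numerator, thus at most \<open>n\<close>. The cofactor is constant, and 1 by
  monicity.\<close>

lemma rat_simple_poles:
  assumes inj: "inj_on \<zeta> {1..n+1}" and poles: "rat_poles R = \<zeta> ` {1..n+1}" and deg: "rat_degree R = n + 1"
  defines "K \<equiv> {k\<in>{1..n+1}. \<zeta> k \<noteq> None}"
  shows "rat_den R = linprod K (\<lambda>k. the (\<zeta> k))"
    and "degree (rat_num R) \<le> card K + 1" "card K < degree (rat_num R) \<Longrightarrow> card K = n"
proof -
  have fin: "finite K" by (simp add: K_def)
  have inj': "inj_on (\<lambda>k. the (\<zeta> k)) K"
  proof (rule inj_onI)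
    fix k l assume kl: "k \<in> K" "l \<in> K" "the (\<zeta> k) = the (\<zeta> l)"
    then have "\<zeta> k = \<zeta> l" by (auto simp: K_def)
    then show "k = l" using inj_onD[OF inj, of k l] kl by (simp add: K_def)
  qed
  have "poly (rat_den R) (the (\<zeta> k)) = 0" if "k \<in> K" for k
  proof -
    have "Some (the (\<zeta> k)) \<in> rat_poles R" using that poles by (auto simp: K_def)
    then show ?thesis by (simp add: rat_poles_def split: if_splits)
  qed
  then have "linprod K (\<lambda>k. the (\<zeta> k)) dvd rat_den R"
    by (rule linprod_dvd[OF inj' fin])
  then obtain q where q: "rat_den R = linprod K (\<lambda>k. the (\<zeta> k)) * q" by auto
  have "q \<noteq> 0" using q rat_den_nonzero[of R] by auto
  then have dq: "degree (rat_den R) = card K + degree q" by (simp add: q degree_mult_eq)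
  have le: "degree (rat_num R) \<le> n + 1" "degree (rat_den R) \<le> n + 1"
    using deg by (auto simp: rat_degree_def)
  have inf: "None \<in> \<zeta> ` {1..n+1} \<longleftrightarrow> degree (rat_num R) > degree (rat_den R)"
    unfolding poles[symmetric] rat_poles_def by simp
  have K: "None \<notin> \<zeta> ` {1..n+1} \<Longrightarrow> card K = n + 1" "None \<in> \<zeta> ` {1..n+1} \<Longrightarrow> card K = n" "n \<le> card K"
    unfolding K_def using card_finite_points[OF inj] by blast+
  have "degree q = 0"
  proof (cases "None \<in> \<zeta> ` {1..n+1}")
    case True
    then show ?thesis using inf le dq K(2) by simp
  next
    case False
    then show ?thesis using le dq K(1) by simp
  qed
  then obtain b where "q = [:b:]" by (metis degree_eq_zeroE)
  moreover have "lead_coeff q = 1"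
    using rat_den_monic[of R] lead_coeff_linprod[of K "\<lambda>k. the (\<zeta> k)"] by (simp add: q lead_coeff_mult)
  ultimately have "q = 1" by (simp add: one_pCons)
  then show "rat_den R = linprod K (\<lambda>k. the (\<zeta> k))" by (simp add: q)
  show "degree (rat_num R) \<le> card K + 1" using le(1) K(3) by simp
  show "card K = n" if "card K < degree (rat_num R)"
    using that inf dq \<open>degree q = 0\<close> K(2) by simp
qed

section \<open>From the particle system back to \<open>Qpoly\<close> and \<open>R\<close>\<close>

theorem theorem2p10:
  fixes n :: nat
    and x :: "nat \<Rightarrow> real"
    and \<zeta> :: "nat \<Rightarrow> sphere"
    and T :: ereal
    and X :: "real \<Rightarrow> nat \<Rightarrow> real"
    and \<sigma> :: "complex \<Rightarrow> ereal"
    and g :: "real \<Rightarrow> complex \<Rightarrow> complex"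
  assumes n: "n \<ge> 1"
    and x_distinct: "inj_on x {1..2*n}"
    and zeta_distinct: "inj_on \<zeta> {1..n+1}"
    and disjoint: "\<forall>k\<in>{1..n+1}. \<forall>j\<in>{1..2*n}. \<zeta> k \<noteq> Some (of_real (x j))"
    and conj_closed: "map_option cnj ` \<zeta> ` {1..n+1} = \<zeta> ` {1..n+1}"
    and stationary: "stationary n x \<zeta>"
    and T_pos: "0 < T"
    and chain: "quarter_superposition n x \<zeta> T X \<sigma> g"
    and before_collision: "no_collision n \<zeta> T X \<sigma> g"
  shows "(\<forall>t z. 0 \<le> t \<and> ereal t < T \<longrightarrow>
            ((\<lambda>s. Qpoly n \<zeta> g s z) has_vector_derivative
               - (1/2) * deriv (deriv (Qpoly n \<zeta> g t)) z) (at t within {0..}))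
       \<and> (\<forall>R \<in> CRR (n+1) (x ` {1..2*n}). rat_poles R = \<zeta> ` {1..n+1} \<longrightarrow>
            (\<exists>Rt :: real \<Rightarrow> complex poly fract.
               (\<forall>t w. 0 \<le> t \<and> ereal t < T \<and> 0 < Im w \<longrightarrow>
                  rat_map (Rt t) (Some w)
                    = rat_map R (Some (inv_into (upper_domain \<sigma> t) (g t) w))) \<and>
               (\<forall>t z. 0 \<le> t \<and> ereal t < T \<and> Qpoly n \<zeta> g t z \<noteq> 0 \<longrightarrow>
                  ((\<lambda>s. rat_eval (Rt s) z) has_vector_derivative
                     - (1/2) * deriv (deriv (rat_eval (Rt t))) z
                     - deriv (Qpoly n \<zeta> g t) z / Qpoly n \<zeta> g t z * deriv (rat_eval (Rt t)) z)
                    (at t within {0..}))))"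
proof -
  define I where "I = {1..2*n}"
  define K where "K = {k\<in>{1..n+1}. \<zeta> k \<noteq> None}"
  define xs where "xs t j = complex_of_real (X t j)" for t j
  define zs where "zs t k = g t (the (\<zeta> k))" for t k
  have 0: "0 \<le> (0::real)" "ereal 0 < T" using T_pos by (simp_all flip: zero_ereal_def)
  interpret stationary_flow I K xs zs T
    using superposition_flow[OF n zeta_distinct stationary T_pos chain before_collision]
    unfolding I_def K_def xs_def zs_def .
  have lc: "loewner_chain (2*n) X T \<sigma> g" and X0: "\<And>j. j \<in> I \<Longrightarrow> X 0 j = x j"
    using chain unfolding quarter_superposition_def I_def by auto
  have alive: "T \<le> \<sigma> (the (\<zeta> k))" if "k \<in> K" for k
    using before_collision that unfolding no_collision_def K_def by auto
  have zs0: "zs 0 k = the (\<zeta> k)" if "k \<in> K" for k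
    unfolding zs_def by (rule loewner_chain_initial[OF lc]) (rule less_le_trans[OF T_pos alive[OF that]])
  have Qpoly: "Qpoly n \<zeta> g t = poly (Q t)" for t
    unfolding Q_def by (intro ext) (simp only: Qpoly_def poly_linprod zs_def K_def)
  have deriv_poly: "deriv (poly p) = poly (pderiv p)" for p :: "complex poly"
    by (intro ext DERIV_imp_deriv poly_DERIV)
  have "((\<lambda>s. Qpoly n \<zeta> g s z) has_vector_derivative
      - (1/2) * deriv (deriv (Qpoly n \<zeta> g t)) z) (at t within {0..})" if t: "0 \<le> t" "ereal t < T" for t z
    using has_vector_derivative_poly[OF Q_deriv[OF t], of z]
    unfolding Qpoly deriv_poly backward_heat[OF t] by simp
  moreover have "\<exists>Rt :: real \<Rightarrow> complex poly fract.
      (\<forall>t w. 0 \<le> t \<and> ereal t < T \<and> 0 < Im w \<longrightarrow>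
         rat_map (Rt t) (Some w) = rat_map R (Some (inv_into (upper_domain \<sigma> t) (g t) w))) \<and>
      (\<forall>t z. 0 \<le> t \<and> ereal t < T \<and> Qpoly n \<zeta> g t z \<noteq> 0 \<longrightarrow>
         ((\<lambda>s. rat_eval (Rt s) z) has_vector_derivative
            - (1/2) * deriv (deriv (rat_eval (Rt t))) z
            - deriv (Qpoly n \<zeta> g t) z / Qpoly n \<zeta> g t z * deriv (rat_eval (Rt t)) z)
           (at t within {0..}))"
    if R: "R \<in> CRR (n+1) (x ` {1..2*n})" and poles: "rat_poles R = \<zeta> ` {1..n+1}" for R
  proof -
    have deg: "rat_degree R = n + 1"
      and crit_set: "{a. sphere_critical (rat_map R) a} = (\<lambda>y. Some (complex_of_real y)) ` x ` I"
      using R unfolding CRR_def I_def by blast+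
    have crit: "sphere_critical (rat_map R) (Some (xs 0 j))" if "j \<in> I" for j
    proof -
      have "Some (xs 0 j) \<in> {a. sphere_critical (rat_map R) a}"
        unfolding crit_set xs_def X0[OF that] using that by (intro imageI)
      then show ?thesis by (rule CollectD)
    qed
    note simple = rat_simple_poles[OF zeta_distinct poles deg, folded K_def]
    have den: "rat_den R = Q 0"
      unfolding simple(1) Q_def linprod_def by (intro prod.cong refl) (simp add: zs0)
    obtain c G \<kappa> where c: "c \<noteq> 0" and G: "pderiv G = [:\<kappa>:]" and num0: "num c G 0 = rat_num R"
      and w0: "pderiv (num c G 0) * Q 0 - num c G 0 * pderiv (Q 0) = smult c (P 0)"
    proof (rule initial_data[of "rat_num R"])
      show "poly (pderiv (rat_num R) * Q 0 - rat_num R * pderiv (Q 0)) (xs 0 i) = 0" if "i \<in> I" for i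
        using sphere_critical_finite[OF crit[OF that]] Q_x_nz[OF 0 that] unfolding den by blast
      show "poly (rat_num R) (zs 0 k) \<noteq> 0" if "k \<in> K" for k
        by (rule rat_num_nz_at_pole) (simp add: den Q_\<zeta>[OF 0 that])
      show "degree (rat_num R) \<le> card K + 1" by (rule simple(2))
      show "card I = 2 * card K" if "card K < degree (rat_num R)"
        using simple(3)[OF that] by (simp add: I_def)
      \<comment> \<open>There are at most \<open>n + 1\<close> finite poles against
        \<open>2 * n\<close> critical points.\<close>
      have "card K \<le> card {1..n+1}" unfolding K_def by (intro card_mono) auto
      then show "2 * card K \<le> card I + 2" by (simp add: I_def)
    qed (rule that)
    define Rt where "Rt t = Fract (num c G t) (Q t)" for t
    have Q_nz: "Q t \<noteq> 0" for t by (simp add: Q_def)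
    have eval: "rat_eval (Rt s) z = poly (num c G s) z / poly (Q s) z" if "poly (Q s) z \<noteq> 0" for s z
      unfolding Rt_def by (rule rat_eval_Fract[OF that])
    \<comment> \<open>The equality is one in the sphere, so roots of \<open>Q t\<close> have to be
      matched with poles of \<open>R\<close>.\<close>
    have "rat_map (Rt t) (Some w) = rat_map R (Some (inv_into (upper_domain \<sigma> t) (g t) w))"
      if t: "0 \<le> t" "ereal t < T" and w: "0 < Im w" for t w
    proof -
      have before: "ereal s < T" if "s \<in> {0..t}" for s
        using that t by (auto intro: order.strict_trans1[of _ "ereal t"])
      have X_cont: "continuous_on {0..t} (\<lambda>s. X s j)" if "j \<in> {1..2*n}" for j
      proof -
        have "continuous_on {0..t} (\<lambda>s. xs s j)"
          by (rule continuous_on_vector_derivative,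
              rule has_vector_derivative_within_subset[OF x_deriv])
             (use that before in \<open>auto simp: I_def\<close>)
        then have "continuous_on {0..t} (\<lambda>s. Re (xs s j))" by (intro continuous_intros)
        then show ?thesis by (simp add: xs_def)
      qed
      define z where "z = inv_into (upper_domain \<sigma> t) (g t) w"
      \<comment> \<open>Surjectivity makes \<open>inv_into\<close> return a genuine preimage of
        \<open>w\<close> that is alive at time \<open>t\<close>.\<close>
      have "w \<in> g t ` upper_domain \<sigma> t"
        using loewner_surj[OF lc X_cont t w] by blast
      then have z: "z \<in> upper_domain \<sigma> t" and gz: "g t z = w"
        unfolding z_def by (auto intro: inv_into_into f_inv_into_f)
      have \<sigma>z: "ereal s < \<sigma> z" if "s \<in> {0..t}" for s
        using z that by (auto simp: upper_domain_def intro: order.strict_trans1[of _ "ereal t"])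
      have g0: "g 0 z = z"
        using \<sigma>z[of 0] t by (intro loewner_chain_initial[OF lc]) (simp flip: zero_ereal_def)
      have flow: "((\<lambda>s. g s z) has_vector_derivative (\<Sum>i\<in>I. (1/2) / (g s z - xs s i))) (at s within {0..})"
        and avoid: "\<And>i. i \<in> I \<Longrightarrow> g s z \<noteq> xs s i"
        if "s \<in> {0..t}" for s
        using loewner_chain_deriv[OF lc, of s z] loewner_chain_avoids[OF lc, of s z] \<sigma>z[OF that] that
        by (auto simp: I_def xs_def)
      \<comment> \<open>The trajectory of \<open>z\<close> meets a marked point only if it starts
        there, so \<open>w\<close> is a root of \<open>Q t\<close> exactly when \<open>z\<close> is
        a root of \<open>Q 0\<close>.\<close>
      have apart: "g s z = zs s k \<longleftrightarrow> z = zs 0 k" if s: "s \<in> {0..t}" and k: "k \<in> K" for s k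
      proof -
        have "g s z = zs s k \<longleftrightarrow> g 0 z = zs 0 k"
        proof (rule loewner_difference[where J = I and x = xs, OF finite_I])
          show "continuous_on {0..t} (\<lambda>s. xs s j)" if "j \<in> I" for j
            unfolding xs_def using X_cont that by (intro continuous_on_of_real) (simp add: I_def)
          show "((\<lambda>s. g s z) has_vector_derivative (\<Sum>j\<in>I. (1/2) / (g r z - xs r j))) (at r within {0..t})"
            if "r \<in> {0..t}" for r
            by (rule has_vector_derivative_within_subset[OF flow[OF that]]) auto
          show "((\<lambda>s. zs s k) has_vector_derivative (\<Sum>j\<in>I. (1/2) / (zs r k - xs r j))) (at r within {0..t})"
            if "r \<in> {0..t}" for r
            by (rule has_vector_derivative_within_subset[OF \<zeta>_deriv[OF _ before[OF that] k]]) (use that in auto)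
          show "g r z \<noteq> xs r j \<and> zs r k \<noteq> xs r j" if "r \<in> {0..t}" "j \<in> I" for r j
            using avoid[OF that] disjoint[OF _ before[OF that(1)] that(2) k] that(1) by auto
        qed (use s in auto)
        then show ?thesis by (simp add: g0)
      qed
      have Rt_w: "rat_map (Rt t) (Some w)
          = (if poly (Q t) w = 0 then None else Some (poly (num c G t) w / poly (Q t) w))"
        unfolding Rt_def
        by (rule rat_map_Fract[OF Q_nz]) (use num_\<zeta>_nz[OF t _ c] Q_root_iff in auto)
      have R_z: "rat_map R (Some z)
          = (if poly (Q 0) z = 0 then None else Some (poly (num c G 0) z / poly (Q 0) z))"
        by (simp add: den rat_eval_def num0)
      have roots: "poly (Q s) (g s z) = 0 \<longleftrightarrow> poly (Q 0) z = 0" if "s \<in> {0..t}" for s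
        unfolding Q_root_iff using apart[OF that] by blast
      have root_w: "poly (Q t) w = 0 \<longleftrightarrow> poly (Q 0) z = 0"
        using roots[of t] t(1) unfolding gz by simp
      have quotient: "poly (num c G t) w / poly (Q t) w = poly (num c G 0) z / poly (Q 0) z"
        if "poly (Q 0) z \<noteq> 0"
      proof -
        have "poly (num c G t) (g t z) / poly (Q t) (g t z) = poly (num c G 0) (g 0 z) / poly (Q 0) (g 0 z)"
          by (rule constant_along_flow[OF t G w0 flow]) (use avoid roots that in auto)
        then show ?thesis unfolding gz g0 .
      qed
      show ?thesis
        unfolding z_def[symmetric] Rt_w R_z root_w using quotient by simp
    qed
    moreover have "((\<lambda>s. rat_eval (Rt s) z) has_vector_derivative
            - (1/2) * deriv (deriv (rat_eval (Rt t))) z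
            - deriv (Qpoly n \<zeta> g t) z / Qpoly n \<zeta> g t z * deriv (rat_eval (Rt t)) z)
           (at t within {0..})" if t: "0 \<le> t" "ereal t < T" and nz: "Qpoly n \<zeta> g t z \<noteq> 0" for t z
      using rational_parabolic[OF t G w0 eval, where z = z] nz unfolding Qpoly deriv_poly by blast
    ultimately show ?thesis by blast
  qed
  ultimately show ?thesis by blast
qed

end
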